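(* Let $N\ge 0$ be an integer and let $q,C,x$ be nonzero complex numbers such that none of the denominators below vanish. For any $f(x)\in \mathcal{L}_{N}(P(x),Q(x))$ we have the expansion $$\bigg(\frac{C}{x}\bigg)^N\frac{(q,C^2q;q,p)_{N}}{(Cxq,Cq/x;q,p)_{N}}\,f(x)=\sum_{k=0}^{N}q^{k}\,\frac{\theta(C^2q^{2k};p)}{\theta(C^2;p)}\,\frac{(C^2,C/x,Cx,q^{-N};q,p)_{k}}{(q,Cxq,Cq/x,C^2q^{N+1};q,p)_{k}}\,f\big(Cq^k\big).$$
   Context: Let $p\in\mathbb{C}$, $|p|<1$. Write $(x;p)_\infty=\prod_{n=0}^\infty(1-xp^n)$. The modified Jacobi theta function is $\theta(x;p)=\prod_{n=0}^{\infty}(1-xp^n)(1-p^{n+1}/x)$ for $x\ne 0$. The theta $q,p$-shifted factorial is $(x;q,p)_n=\prod_{k=0}^{n-1}\theta(xq^k;p)$, and $(x_1,\dots,x_m;q,p)_n=\prod_{k=1}^m(x_k;q,p)_n$. Empty products equal $1$. Define $P(x)=\theta(-x^2;p^2)\,(-p;p)_\infty$ and $Q(x)=x\,\theta(-px^2;p^2)\,(-p;p)_\infty$ for $x\ne0$, where $\theta(-px^2;p^2)=\prod_{n\ge 0}(1+p^{2n+1}x^2)(1+p^{2n+1}/x^2)$. For an integer $N\ge 0$, $\mathcal{L}_N(P(x),Q(x))$ denotes the set of all functions of the form $\sum_{k=0}^{N}\lambda_kP(x)^kQ(x)^{N-k}$ with complex coefficients $\lambda_k$ independent of $x$ ("elliptic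 Askey-Wilson polynomials of degree $N$"). *)

theory Defs
  imports "HOL-Analysis.Analysis"
begin

definition pochhammer_inf :: "complex \<Rightarrow> complex \<Rightarrow> complex" where
  "pochhammer_inf x p = (\<Prod>n. 1 - x * p ^ n)"

definition jtheta :: "complex \<Rightarrow> complex \<Rightarrow> complex" where
  "jtheta x p = (\<Prod>n. (1 - x * p ^ n) * (1 - p ^ (n + 1) / x))"

definition theta_fact :: "complex \<Rightarrow> complex \<Rightarrow> complex \<Rightarrow> nat \<Rightarrow> complex" where
  "theta_fact x q p n = (\<Prod>k<n. jtheta (x * q ^ k) p)"

definition theta_facts :: "complex list \<Rightarrow> complex \<Rightarrow> complex \<Rightarrow> nat \<Rightarrow> complex" where
  "theta_facts xs q p n = (\<Prod>x\<leftarrow>xs. theta_fact x q p n)"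

definition ellP :: "complex \<Rightarrow> complex \<Rightarrow> complex" where
  "ellP p x = jtheta (- (x ^ 2)) (p ^ 2) * pochhammer_inf (- p) p"

text \<open>For \<open>p = 0\<close> the first argument of the theta function below is \<open>0\<close>; since \<open>y / 0 = 0\<close>,
  its value is then \<open>1\<close>, in agreement with the product expansion in \<open>jtheta_ellQ\<close>.\<close>
definition ellQ :: "complex \<Rightarrow> complex \<Rightarrow> complex" where
  "ellQ p x = x * jtheta (- p * x ^ 2) (p ^ 2) * pochhammer_inf (- p) p"

lemma jtheta_ellQ:
  assumes "x \<noteq> 0"
  shows "jtheta (- p * x ^ 2) (p ^ 2) =
    (\<Prod>n. (1 + p ^ (2 * n + 1) * x ^ 2) * (1 + p ^ (2 * n + 1) / x ^ 2))"
proof -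
  have "(1 - - p * x ^ 2 * (p ^ 2) ^ n) * (1 - (p ^ 2) ^ (n + 1) / (- p * x ^ 2)) =
      (1 + p ^ (2 * n + 1) * x ^ 2) * (1 + p ^ (2 * n + 1) / x ^ 2)" for n
    using assms
    by (cases "p = 0") (simp_all add: field_simps power2_eq_square mult_2_right power_add power_mult_distrib)
  then show ?thesis
    unfolding jtheta_def by presburger
qed

text \<open>The functions in question live on the nonzero complex numbers, so membership does not
  constrain the value at \<open>0\<close>.\<close>
definition elliptic_AW :: "nat \<Rightarrow> (complex \<Rightarrow> complex) \<Rightarrow> (complex \<Rightarrow> complex) \<Rightarrow> (complex \<Rightarrow> complex) set"
  where "elliptic_AW N P Q =
    {f. \<exists>l :: nat \<Rightarrow> complex. \<forall>x. x \<noteq> 0 \<longrightarrow> f x = (\<Sum>k\<le>N. l k * P x ^ k * Q x ^ (N - k))}"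

end

theory Submission
  imports Defs
begin

text \<open>
A function \<open>f\<close> in \<open>elliptic_AW N (ellP p) (ellQ p)\<close> is a binary form of degree \<open>N\<close> evaluated at
\<open>(P(z), Q(z))\<close>, so it is determined by its values at \<open>N + 1\<close> points of the projective line. The
expansion is Lagrange interpolation (\<open>homogeneous_lagrange\<close>) at the nodes given by \<open>z = C q\<^sup>k\<close>,
\<open>0 \<le> k \<le> N\<close>. Its coefficients are products of quotients of the determinants
\<open>P(x) Q(y) - Q(x) P(y)\<close>, and these become explicit because each determinant factors:
\<open>P(x) Q(y) - Q(x) P(y) = y \<theta>(x y; p) \<theta>(x / y; p)\<close>
(\<open>theta_addition\<close>). Substituting this and collecting the theta functions into shifted factorials
(\<open>interpolation_weight\<close>) gives the stated coefficients.

The factorisation comes from the Jacobi triple product identity. Up to a factor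
depending on \<open>p\<close> only, it turns \<open>y \<theta>(x y; p) \<theta>(x / y; p)\<close> into a double series over pairs \<open>(m, n)\<close> of integers. The pairs with
\<open>m + n\<close> even, written as \<open>(s + t, s - t)\<close>, separate into the series of \<open>P(x)\<close> times that of \<open>Q(y)\<close>;
the pairs with \<open>m + n\<close> odd, written as \<open>(s + t, s - t + 1)\<close>, give \<open>- Q(x) P(y)\<close>. The triple
product itself is the limit of an identity with finite products and \<open>q\<close>-binomial coefficients
(\<open>finite_triple_product\<close>), taken by dominated convergence.

Interpolation needs the nodes to be distinct, that is, \<open>\<theta>(q\<^sup>i; p) \<noteq> 0\<close> for \<open>1 \<le> i \<le> N\<close> and
\<open>\<theta>(C\<^sup>2 q\<^sup>i; p) \<noteq> 0\<close> for \<open>1 \<le> i < 2 N\<close>. The denominators in the statement give the former, but the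
latter only for \<open>i > N\<close>. If \<open>\<theta>(C\<^sup>2 q\<^sup>i; p) = 0\<close> for some \<open>1 \<le> i \<le> N\<close>, two nodes coincide on the
projective line and the identity is a limiting case: both sides are continuous in \<open>C\<close>, and the
values of \<open>C\<close> with coinciding nodes form a countable set, hence can be avoided arbitrarily
close to any given \<open>C\<close>.
\<close>

section \<open>Infinite shifted factorials and theta functions\<close>

lemma convergent_prod_pochhammer:
  assumes "norm p < 1"
  shows "convergent_prod (\<lambda>n. 1 - x * p ^ n :: complex)"
proof -
  have "summable (\<lambda>n. norm (1 - x * p ^ n - 1))"
    using assms by (simp add: norm_mult norm_power summable_mult summable_geometric)
  then show ?thesis
    using abs_convergent_prod_conv_summable abs_convergent_prod_imp_convergent_prod by blast
qed

lemma pochhammer_inf_LIMSEQ: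
  assumes "norm p < 1"
  shows "(\<lambda>n. \<Prod>k<n. 1 - x * p ^ k) \<longlonglongrightarrow> pochhammer_inf x p"
  unfolding pochhammer_inf_def
  by (rule LIMSEQ_imp_Suc)
    (use convergent_prod_LIMSEQ[OF convergent_prod_pochhammer[OF assms, of x]] in \<open>simp only:
      lessThan_Suc_atMost\<close>)

lemma pochhammer_inf_eq_0_iff:
  assumes "norm p < 1"
  shows "pochhammer_inf x p = 0 \<longleftrightarrow> (\<exists>n. x * p ^ n = 1)"
  using has_prod_eq_0_iff[OF
    convergent_prod_has_prod[OF convergent_prod_pochhammer[OF assms, of x]]]
  by (auto simp: pochhammer_inf_def)

lemma pochhammer_inf_rec:
  assumes "norm p < 1"
  shows "pochhammer_inf x p = (1 - x) * pochhammer_inf (p * x) p"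
proof -
  have "(\<lambda>n. \<Prod>k<Suc n. 1 - x * p ^ k) = (\<lambda>n. (1 - x) * (\<Prod>k<n. 1 - (p * x) * p ^ k))"
    by (simp add: prod.lessThan_Suc_shift mult_ac del: prod.lessThan_Suc)
  then have "(\<lambda>n. (1 - x) * (\<Prod>k<n. 1 - (p * x) * p ^ k)) \<longlonglongrightarrow> pochhammer_inf x p"
    using LIMSEQ_Suc[OF pochhammer_inf_LIMSEQ[OF assms, of x]] by simp
  moreover have "(\<lambda>n. (1 - x) * (\<Prod>k<n. 1 - (p * x) * p ^ k)) \<longlonglongrightarrow> (1 - x) * pochhammer_inf (p * x) p"
    by (intro tendsto_intros pochhammer_inf_LIMSEQ assms)
  ultimately show ?thesis
    by (rule LIMSEQ_unique)
qed

lemma jtheta_eq_pochhammer_inf: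
  assumes "norm p < 1"
  shows "jtheta z p = pochhammer_inf z p * pochhammer_inf (p / z) p"
  unfolding jtheta_def pochhammer_inf_def
  using convergent_prod_pochhammer[OF assms, of z] convergent_prod_pochhammer[OF assms, of "p / z"]
  by (subst prodinf_mult) simp_all

text \<open>
Both \<open>\<theta>(z; p)\<close> and \<open>\<theta>(1 / z; p)\<close> contain the infinite products \<open>(p z; p)\<close> and \<open>(p / z; p)\<close>;
they differ only in the first factors \<open>1 - z\<close> and \<open>1 - 1 / z\<close>.
\<close>
lemma jtheta_inverse:
  assumes "norm p < 1" "z \<noteq> 0"
  shows "jtheta (1 / z) p = - jtheta z p / z"
proof -
  have "jtheta (1 / z) p = (1 - 1 / z) * pochhammer_inf (p / z) p * pochhammer_inf (p * z) p"
    using pochhammer_inf_rec[OF assms(1), of "1 / z"] by (simp add: jtheta_eq_pochhammer_inf assms)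
  moreover have "jtheta z p = (1 - z) * pochhammer_inf (p * z) p * pochhammer_inf (p / z) p"
    using pochhammer_inf_rec[OF assms(1), of z] by (simp add: jtheta_eq_pochhammer_inf assms)
  moreover have "1 - 1 / z = - (1 - z) / z"
    using assms(2) by (simp add: field_simps)
  ultimately show ?thesis
    by (simp only: mult_minus_left mult_minus_right divide_inverse mult_ac)
qed

lemma pochhammer_inf_square:
  assumes "norm p < 1"
  shows "pochhammer_inf (p ^ 2) (p ^ 2) = pochhammer_inf p p * pochhammer_inf (- p) p"
proof -
  have "1 - p ^ 2 * (p ^ 2) ^ n = (1 - p * p ^ n) * (1 - - p * p ^ n)" for n
    by (simp add: power2_eq_square power_mult_distrib algebra_simps)
  then show ?thesis
    unfolding pochhammer_inf_def
    by (subst prodinf_mult) (simp_all only: convergent_prod_pochhammer assms)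
qed

text \<open>
On every disc of radius \<open>R\<close> the factors deviate from \<open>1\<close> by at most \<open>R |p|\<^sup>n\<close>, so the
partial products converge uniformly there.
\<close>
lemma continuous_on_pochhammer_inf:
  assumes "norm p < 1"
  shows "continuous_on UNIV (\<lambda>x. pochhammer_inf x p)"
proof -
  have "continuous_on (ball 0 R) (\<lambda>x. pochhammer_inf x p)" for R
  proof -
    have "uniformly_convergent_on (cball 0 R) (\<lambda>N x. \<Sum>n<N. norm (1 - x * p ^ n - 1))"
    proof (rule Weierstrass_m_test')
      show "norm (norm (1 - x * p ^ n - 1)) \<le> R * norm p ^ n" if "x \<in> cball 0 R" for n x
        using that by (simp add: norm_mult norm_power mult_right_mono)
      show "summable (\<lambda>n. R * norm p ^ n)"
        using assms by (simp add: summable_mult summable_geometric)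
    qed
    then have "uniformly_convergent_on (cball 0 R) (\<lambda>N x. \<Prod>n<N. 1 - x * p ^ n)"
      by (intro uniformly_convergent_on_prod') (auto intro!: continuous_intros)
    then obtain l where l: "uniform_limit (cball 0 R) (\<lambda>N x. \<Prod>n<N. 1 - x * p ^ n) l sequentially"
      by (auto simp: uniformly_convergent_on_def)
    then have c: "continuous_on (cball 0 R) l"
      by (rule uniform_limit_theorem[rotated]) (auto intro!: continuous_intros always_eventually)
    have "l x = pochhammer_inf x p" if "x \<in> cball 0 R" for x
      using tendsto_uniform_limitI[OF l that] pochhammer_inf_LIMSEQ[OF assms, of x] LIMSEQ_unique
        by blast
    then have "continuous_on (cball 0 R) (\<lambda>x. pochhammer_inf x p)"
      using c by (metis (no_types, lifting) continuous_on_cong)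
    then show ?thesis
      by (rule continuous_on_subset) auto
  qed
  then have "continuous_on (\<Union>R. ball 0 R) (\<lambda>x. pochhammer_inf x p)"
    by (intro continuous_on_open_UN) auto
  moreover have "(\<Union>R. ball (0::complex) R) = UNIV"
    by (auto intro: gt_ex)
  ultimately show ?thesis by simp
qed

lemma tendsto_pochhammer_inf [tendsto_intros]:
  assumes "norm p < 1" "(g \<longlongrightarrow> c) F"
  shows "((\<lambda>x. pochhammer_inf (g x) p) \<longlongrightarrow> pochhammer_inf c p) F"
  using continuous_on_tendsto_compose[OF continuous_on_pochhammer_inf[OF assms(1)] assms(2)] by simp

lemma tendsto_jtheta [tendsto_intros]:
  assumes "norm p < 1" "(g \<longlongrightarrow> c) F" "c \<noteq> 0"
  shows "((\<lambda>x. jtheta (g x) p) \<longlongrightarrow> jtheta c p) F"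
  unfolding jtheta_eq_pochhammer_inf[OF assms(1)] using assms by (intro tendsto_intros)

text \<open>
The product can only vanish through one of its factors, that is, at a power of \<open>p\<close>.
\<close>
lemma countable_zeros_jtheta:
  assumes "norm p < 1"
  shows "countable {z. z \<noteq> 0 \<and> jtheta z p = 0}"
proof -
  have "z \<in> range (\<lambda>n. 1 / p ^ n) \<union> range (\<lambda>n. p * p ^ n)" if z: "z \<noteq> 0" "jtheta z p = 0" for z
  proof -
    from z(2) consider n where "z * p ^ n = 1" | n where "p / z * p ^ n = 1"
      by (auto simp: jtheta_eq_pochhammer_inf pochhammer_inf_eq_0_iff assms)
    then show ?thesis
    proof cases
      case 1
      then have "z = 1 / p ^ n" by (metis divide_eq_eq eq_divide_eq mult_zero_right zero_neq_one)
      then show ?thesis by blast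
    next
      case 2
      then have "z = p * p ^ n" using z(1) by simp
      then show ?thesis by blast
    qed
  qed
  then have "{z. z \<noteq> 0 \<and> jtheta z p = 0} \<subseteq> range (\<lambda>n. 1 / p ^ n) \<union> range (\<lambda>n. p * p ^ n)"
    by blast
  then show ?thesis
    by (rule countable_subset) simp
qed

lemma tendsto_ellP [tendsto_intros]:
  assumes "norm p < 1" "(g \<longlongrightarrow> c) F" "c \<noteq> 0"
  shows "((\<lambda>x. ellP p (g x)) \<longlongrightarrow> ellP p c) F"
proof -
  have "norm (p ^ 2) < 1"
    using assms(1) by (simp add: norm_power power_less_one_iff)
  then show ?thesis
    unfolding ellP_def using assms by (intro tendsto_intros) auto
qed

text \<open>
The series and continuity arguments need the product for \<open>Q\<close> with \<open>p / x\<^sup>2\<close> in place of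
\<open>p\<^sup>2 / (p x\<^sup>2)\<close>: the latter does not make sense at \<open>p = 0\<close>, while this form covers all
\<open>p\<close> in the unit disc.
\<close>
lemma ellQ_eq:
  assumes "norm p < 1"
  shows "ellQ p x = x * (pochhammer_inf (- p * x ^ 2) (p ^ 2)
    * pochhammer_inf (- p / x ^ 2) (p ^ 2))
    * pochhammer_inf (- p) p"
proof -
  have "norm (p ^ 2) < 1"
    using assms(1) by (simp add: norm_power power_less_one_iff)
  then show ?thesis
  by (cases "p = 0") (simp_all add: ellQ_def jtheta_eq_pochhammer_inf power2_eq_square)
qed

lemma tendsto_ellQ [tendsto_intros]:
  assumes "norm p < 1" "(g \<longlongrightarrow> c) F" "c \<noteq> 0"
  shows "((\<lambda>x. ellQ p (g x)) \<longlongrightarrow> ellQ p c) F"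
proof -
  have "norm (p ^ 2) < 1"
    using assms(1) by (simp add: norm_power power_less_one_iff)
  then show ?thesis
    unfolding ellQ_eq[OF assms(1)] using assms by (intro tendsto_intros) auto
qed

section \<open>The Jacobi triple product identity\<close>

text \<open>
The general term of Ramanujan's theta series in \<open>a\<close> and \<open>b\<close>. With two variables both exponents are
nonnegative, so that no division by \<open>p\<close> occurs when the series are specialised to theta functions
of nome \<open>p = a b\<close>, and the series identities include the case \<open>p = 0\<close>.
\<close>
definition ramanujan_term :: "complex \<Rightarrow> complex \<Rightarrow> int \<Rightarrow> complex" where
  "ramanujan_term a b j = a ^ nat (j * (j + 1) div 2) * b ^ nat (j * (j - 1) div 2)"

lemma triangular_nonneg: "0 \<le> j * (j + 1) div (2::int)"
proof (cases "j \<ge> 0")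
  case False
  then have "0 \<le> (- j) * (- j - 1)" by (intro mult_nonneg_nonneg) auto
  then show ?thesis by (simp add: algebra_simps)
qed auto

lemma triangular_pred_nonneg: "0 \<le> j * (j - 1) div (2::int)"
  using triangular_nonneg[of "j - 1"] by (simp add: algebra_simps)

lemma triangular_Suc: "(j + 1) * (j + 1 + 1) div 2 = j * (j + 1) div 2 + (j + 1 :: int)"
proof -
  have "(j + 1) * (j + 1 + 1) = j * (j + 1) + (j + 1) * 2" by (simp add: algebra_simps)
  then show ?thesis by (simp only: div_mult_self1)
qed

lemma triangular_pred_Suc: "(j + 1) * (j + 1 - 1) div 2 = j * (j - 1) div 2 + (j :: int)"
  using triangular_Suc[of "j - 1"] by (simp add: algebra_simps)

lemma ramanujan_term_0: "ramanujan_term a b 0 = 1"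
  by (simp add: ramanujan_term_def)

lemma ramanujan_term_uminus: "ramanujan_term a b (- j) = ramanujan_term b a j"
proof -
  have "- j * (- j + 1) = j * (j - 1)" "- j * (- j - 1) = j * (j + 1)" by (auto simp: algebra_simps)
  then show ?thesis by (simp only: ramanujan_term_def) simp
qed

text \<open>
Multiplication by the next factor's term \<open>a (a b)\<^sup>m\<close> shifts the index by one, up to a power of
\<open>a b\<close>. The bound on \<open>j\<close> keeps the exponent of this power nonnegative.
\<close>
lemma ramanujan_term_step_up:
  assumes "j \<le> int m"
  shows "a * (a * b) ^ m * ramanujan_term a b j
    = (a * b) ^ nat (int m - j) * ramanujan_term a b (j + 1)"
proof -
  define A B where "A = j * (j + 1) div 2" and "B = j * (j - 1) div 2"
  have AB: "A \<ge> 0" "B \<ge> 0" "A + (j + 1) \<ge> 0" "B + j \<ge> 0"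
    using triangular_nonneg[of j] triangular_pred_nonneg[of j] triangular_nonneg[of "j + 1"]
      triangular_pred_nonneg[of "j + 1"]
      triangular_Suc[of j] triangular_pred_Suc[of j] by (auto simp: A_def B_def)
  have *: "Suc m + nat A = nat (int m - j) + nat (A + (j + 1))"
    "m + nat B = nat (int m - j) + nat (B + j)"
    using AB assms by linarith+
  have "a * (a * b) ^ m * ramanujan_term a b j = a ^ (Suc m + nat A) * b ^ (m + nat B)"
    unfolding ramanujan_term_def A_def[symmetric] B_def[symmetric]
      by (simp only: power_mult_distrib power_add power_Suc mult_ac)
  also have "\<dots> = (a * b) ^ nat (int m - j) * ramanujan_term a b (j + 1)"
    unfolding * ramanujan_term_def triangular_Suc triangular_pred_Suc A_def[symmetric]
      B_def[symmetric]
    by (simp only: power_mult_distrib power_add mult_ac)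
  finally show ?thesis .
qed

lemma ramanujan_term_step_down:
  assumes "- int n \<le> j"
  shows "b * (a * b) ^ n * ramanujan_term a b j
    = (a * b) ^ nat (int n + j) * ramanujan_term a b (j - 1)"
  using ramanujan_term_step_up[of "- j" n b a] assms ramanujan_term_uminus[of b a j]
    ramanujan_term_uminus[of b a "j - 1"]
  by (simp add: mult.commute)

text \<open>
The exponents of \<open>a\<close> and \<open>b\<close> differ by \<open>j\<close>, which is why rescaling \<open>a\<close> and \<open>b\<close> inversely only produces a
\<open>j\<close>-th power. This turns the symmetric two-variable terms into Laurent monomials.
\<close>
lemma ramanujan_term_scale:
  assumes "c \<noteq> 0"
  shows "ramanujan_term (c * u) (v / c) j = c powi j * ramanujan_term u v j"
proof -
  have *: "nat (j * (j + 1) div 2) = nat (j * (j - 1) div 2 + j)"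
    using triangular_pred_Suc[of j] by (simp add: algebra_simps)
  have "c ^ nat (j * (j + 1) div 2) = c powi j * c ^ nat (j * (j - 1) div 2)"
    unfolding * using triangular_pred_nonneg[of j] triangular_nonneg[of j] assms
      triangular_pred_Suc[of j]
    by (simp flip: power_int_of_nat power_int_add add: algebra_simps)
  then show ?thesis using assms by (simp add: ramanujan_term_def power_mult_distrib power_divide)
qed

lemma abs_summable_ramanujan_term:
  assumes "norm (a * b) < 1"
  shows "(\<lambda>j. norm (ramanujan_term a b j)) summable_on UNIV"
proof -
  \<comment> \<open>The ratio of consecutive terms is \<open>a (a b)\<^sup>n\<close> and tends to \<open>0\<close>.
    Exchanging \<open>a\<close> and \<open>b\<close> gives the negative indices.\<close>
  have pos: "(\<lambda>j. norm (ramanujan_term a b j)) summable_on range int" if ab: "norm (a * b) < 1"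
    for a b
  proof -
    have "(\<lambda>n. norm a * norm (a * b) ^ n) \<longlonglongrightarrow> norm a * 0"
      using ab by (intro tendsto_intros LIMSEQ_realpow_zero) auto
    then have "eventually (\<lambda>n. norm a * norm (a * b) ^ n < 1/2) sequentially"
      by (rule order_tendstoD) auto
    then obtain N where N: "norm a * norm (a * b) ^ n < 1/2" if "n \<ge> N" for n
      by (auto simp: eventually_sequentially)
    have "summable (\<lambda>n. norm (ramanujan_term a b (int n)))"
    proof (rule summable_ratio_test)
      show "norm (norm (ramanujan_term a b (int (Suc n)))) \<le> 1/2
        * norm (norm (ramanujan_term a b (int n)))" if "n \<ge> N" for n
      proof -
        have "ramanujan_term a b (int (Suc n)) = a * (a * b) ^ n * ramanujan_term a b (int n)"
          using ramanujan_term_step_up[of "int n" n a b] by (simp add: add.commute)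
        then have "norm (ramanujan_term a b (int (Suc n)))
          = (norm a * norm (a * b) ^ n) * norm (ramanujan_term a b (int n))"
          by (simp add: norm_mult norm_power)
        also have "\<dots> \<le> 1/2 * norm (ramanujan_term a b (int n))"
          using N[OF that] by (intro mult_right_mono) auto
        finally show ?thesis by simp
      qed
    qed auto
    then have "(\<lambda>n. norm (ramanujan_term a b (int n))) summable_on UNIV"
      by (simp add: summable_on_UNIV_nonneg_real_iff)
    then show ?thesis
      by (simp add: summable_on_reindex o_def)
  qed
  have "(\<lambda>j. norm (ramanujan_term a b j)) summable_on uminus ` range int"
    using pos[of b a] assms
      by (simp add: summable_on_reindex o_def ramanujan_term_uminus mult.commute)
  then have "(\<lambda>j. norm (ramanujan_term a b j)) summable_on range int \<union> uminus ` range int"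
    using pos[OF assms] by (rule summable_on_union[rotated])
  moreover have "range int \<union> uminus ` range int = UNIV"
    by (auto simp: image_iff) (metis int_cases2)
  ultimately show ?thesis by simp
qed

text \<open>
The Gaussian binomial coefficient, indexed by an integer and extended by zero: sums over a
range of \<open>k\<close> then become sums over all integers, which can be shifted without boundary terms.
\<close>
definition qbinom :: "complex \<Rightarrow> nat \<Rightarrow> int \<Rightarrow> complex" where
  "qbinom r N k = (if 0 \<le> k \<and> k \<le> int N then
     (\<Prod>i<N. 1 - r * r ^ i) / ((\<Prod>i<nat k. 1 - r * r ^ i) * (\<Prod>i<nat (int N - k). 1 - r * r ^ i)) else
       0)"

lemma qfact_nonzero:
  assumes "norm r < 1"
  shows "(\<Prod>i<n. 1 - r * r ^ i :: complex) \<noteq> 0"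
proof -
  have "norm (r * r ^ i) < 1" for i
    using assms by (simp add: norm_power power_less_one_iff flip: power_Suc)
  then have "1 - r * r ^ i \<noteq> 0" for i
    by (metis eq_iff_diff_eq_0 norm_one order_less_irrefl)
  then show ?thesis by simp
qed

lemma qbinom_sym: "qbinom r N k = qbinom r N (int N - k)"
  by (auto simp: qbinom_def mult.commute)

text \<open>
With \<open>k = i + 1\<close> and \<open>N - k = j\<close>, after clearing denominators this is
\<open>1 - r\<^bsup>N+1\<^esup> = (1 - r\<^bsup>j+1\<^esup>) + r\<^bsup>j+1\<^esup> (1 - r\<^bsup>i+1\<^esup>)\<close>.
\<close>
lemma qbinom_pascal:
  assumes "norm r < 1"
  shows "qbinom r (Suc N) k = qbinom r N k + r ^ nat (int N - k + 1) * qbinom r N (k - 1)"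
proof -
  note nz = qfact_nonzero[OF assms]
  consider "k < 0 \<or> k > int (Suc N)" | "k = 0" | "k = int (Suc N)" | "1 \<le> k" "k \<le> int N" by linarith
  then show ?thesis
  proof cases
    case 4
    define i j where "i = nat (k - 1)" and "j = nat (int N - k)"
    have ij: "nat k = Suc i" "nat (int N - k) = j" "nat (int (Suc N) - k) = Suc j" "nat (k - 1) = i"
      "nat (int N - (k - 1)) = Suc j" "nat (int N - k + 1) = Suc j" "Suc N = Suc i + Suc j"
      using 4 by (auto simp: i_def j_def)
    have "r * r ^ N = (r * r ^ i) * (r * r ^ j)"
      using ij(7) by (metis power_Suc power_add)
    define F where "F = (\<lambda>n. \<Prod>i<n. 1 - r * r ^ i)"
    have FS: "F (Suc n) = F n * (1 - r * r ^ n)" for n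
      by (simp add: F_def)
    have nzF: "F n \<noteq> 0" for n using nz by (simp add: F_def)
    have nz1: "1 - r * r ^ n \<noteq> 0" for n using nzF[of "Suc n"] unfolding FS by simp
    have "qbinom r (Suc N) k = F (Suc N) / (F (Suc i) * F (Suc j))"
      "qbinom r N k = F N / (F (Suc i) * F j)" "qbinom r N (k - 1) = F N / (F i * F (Suc j))"
      using 4 ij by (simp_all add: qbinom_def F_def del: prod.lessThan_Suc)
    moreover have "F (Suc N) / (F (Suc i) * F (Suc j))
      = F N / (F (Suc i) * F j) + r * r ^ j * (F N / (F i * F (Suc j)))"
      unfolding FS \<open>r * r ^ N = _\<close> using nz1[of i] nz1[of j] nzF[of i] nzF[of j]
        by (simp add: divide_simps) (simp add: algebra_simps)
    ultimately show ?thesis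
      using ij by simp
  qed (use nz nz[of "Suc N"] in \<open>auto simp: qbinom_def nat_add_distrib simp del: prod.lessThan_Suc\<close>)
qed

lemma qbinom_pascal_sym:
  assumes "norm r < 1"
  shows "qbinom r (Suc N) k = qbinom r N (k - 1) + r ^ nat k * qbinom r N k"
  using qbinom_pascal[OF assms, of N "int (Suc N) - k"] qbinom_sym[of r "Suc N" k]
    qbinom_sym[of r N k] qbinom_sym[of r N "k - 1"]
  by (simp add: algebra_simps)

text \<open>
Attaching one more factor \<open>1 + a (a b)\<^sup>m\<close> or \<open>1 + b (a b)\<^sup>n\<close> adds to the series its own
shift by one in \<open>j\<close>, and the coefficients recombine by one of the two Pascal rules: the first rule for
the factors with \<open>a\<close>, the second for those with \<open>b\<close>.
\<close>
lemma finite_triple_product: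
  assumes "norm (a * b) < 1"
  shows "((\<lambda>j. qbinom (a * b) (m + n) (int n + j) * ramanujan_term a b j) has_sum
    ((\<Prod>k<m. 1 + a * (a * b) ^ k) * (\<Prod>k<n. 1 + b * (a * b) ^ k))) UNIV"
proof -
  have stepa: "((\<lambda>j. qbinom (a * b) (Suc m + n) (int n + j) * ramanujan_term a b j)
    has_sum ((1 + a * (a * b) ^ m) * S)) UNIV"
    if "((\<lambda>j. qbinom (a * b) (m + n) (int n + j) * ramanujan_term a b j) has_sum S) UNIV" for m n S
  proof -
    let ?g = "\<lambda>j. a * (a * b) ^ m
      * (qbinom (a * b) (m + n) (int n + (j - 1)) * ramanujan_term a b (j - 1))"
    have "((\<lambda>j. a * (a * b) ^ m * (qbinom (a * b) (m + n) (int n + j) * ramanujan_term a b j))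
      has_sum (a * (a * b) ^ m * S)) UNIV"
      using that by (rule has_sum_cmult_right)
    then have "(?g has_sum (a * (a * b) ^ m * S)) UNIV"
      by (subst has_sum_reindex_bij_witness[of _ "\<lambda>j. j + 1" "\<lambda>j. j - 1" UNIV
          "\<lambda>j. a * (a * b) ^ m * (qbinom (a * b) (m + n) (int n + j) * ramanujan_term a b j)"]) auto
    from has_sum_add[OF that this] have
      "((\<lambda>j. qbinom (a * b) (m + n) (int n + j) * ramanujan_term a b j + ?g j)
        has_sum (S + a * (a * b) ^ m * S)) UNIV" .
    moreover have "qbinom (a * b) (m + n) (int n + j) * ramanujan_term a b j + ?g j
      = qbinom (a * b) (Suc m + n) (int n + j) * ramanujan_term a b j" for j
    proof (cases "j - 1 \<le> int m")
      case True
      then show ?thesis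
        using ramanujan_term_step_up[of "j - 1" m a b]
          qbinom_pascal[OF assms, of "m + n" "int n + j"]
        by (simp add: algebra_simps)
    next
      case False
      then show ?thesis by (simp add: qbinom_def)
    qed
    ultimately show ?thesis by (simp add: algebra_simps)
  qed
  have stepb: "((\<lambda>j. qbinom (a * b) (m + Suc n) (int (Suc n) + j) * ramanujan_term a b j)
    has_sum ((1 + b * (a * b) ^ n) * S)) UNIV"
    if "((\<lambda>j. qbinom (a * b) (m + n) (int n + j) * ramanujan_term a b j) has_sum S) UNIV" for m n S
  proof -
    let ?g = "\<lambda>j. b * (a * b) ^ n
      * (qbinom (a * b) (m + n) (int n + (j + 1)) * ramanujan_term a b (j + 1))"
    have "((\<lambda>j. b * (a * b) ^ n * (qbinom (a * b) (m + n) (int n + j) * ramanujan_term a b j))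
      has_sum (b * (a * b) ^ n * S)) UNIV"
      using that by (rule has_sum_cmult_right)
    then have "(?g has_sum (b * (a * b) ^ n * S)) UNIV"
      by (subst has_sum_reindex_bij_witness[of _ "\<lambda>j. j - 1" "\<lambda>j. j + 1" UNIV
          "\<lambda>j. b * (a * b) ^ n * (qbinom (a * b) (m + n) (int n + j) * ramanujan_term a b j)"]) auto
    from has_sum_add[OF that this] have
      "((\<lambda>j. qbinom (a * b) (m + n) (int n + j) * ramanujan_term a b j + ?g j)
        has_sum (S + b * (a * b) ^ n * S)) UNIV" .
    moreover have "qbinom (a * b) (m + n) (int n + j) * ramanujan_term a b j + ?g j
      = qbinom (a * b) (m + Suc n) (int (Suc n) + j) * ramanujan_term a b j" for j
    proof (cases "- int n \<le> j + 1")
      case True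
      then show ?thesis
        using ramanujan_term_step_down[of n "j + 1" b a]
          qbinom_pascal_sym[OF assms, of "m + n" "int (Suc n) + j"]
        by (simp add: algebra_simps)
    next
      case False
      then show ?thesis by (simp add: qbinom_def)
    qed
    ultimately show ?thesis by (simp add: algebra_simps)
  qed
  have base: "((\<lambda>j. qbinom (a * b) 0 (int 0 + j) * ramanujan_term a b j) has_sum 1) UNIV"
    by (rule has_sum_finite_neutralI[of "{0}"]) (auto simp: qbinom_def ramanujan_term_0)
  have b: "((\<lambda>j. qbinom (a * b) (0 + n) (int n + j) * ramanujan_term a b j)
    has_sum (\<Prod>k<n. 1 + b * (a * b) ^ k)) UNIV"
  proof (induction n)
    case 0
    then show ?case using base by simp
  next
    case (Suc n)
    then show ?case using stepb[of 0 n, OF Suc.IH] by (simp add: mult.commute)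
  qed
  show ?thesis
  proof (induction m)
    case 0
    then show ?case using b by simp
  next
    case (Suc m)
    then show ?case using stepa[of m n, OF Suc.IH] by (simp add: mult_ac)
  qed
qed

text \<open>
The dominated convergence theorem for integrals, applied to the counting measure on \<open>A\<close>.
\<close>
lemma tendsto_infsum_dominated:
  fixes f :: "nat \<Rightarrow> 'a \<Rightarrow> 'b :: {banach, second_countable_topology}"
  assumes lim: "\<And>j. (\<lambda>n. f n j) \<longlonglongrightarrow> g j"
    and bound: "\<And>n j. norm (f n j) \<le> h j"
    and h: "h summable_on A"
  shows "(\<lambda>n. infsum (f n) A) \<longlonglongrightarrow> infsum g A"
proof -
  have h0: "0 \<le> h j" for j
    using bound[of 0 j] norm_ge_zero order_trans by blast
  have h': "Infinite_Set_Sum.abs_summable_on h A"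
    using h h0 abs_summable_equivalent[of h A] by simp
  have f': "Infinite_Set_Sum.abs_summable_on (f n) A" for n
    using h' by (rule abs_summable_on_comparison_test) (use bound h0 in auto)
  have "norm (g j) \<le> h j" for j
    by (rule tendsto_upperbound[OF tendsto_norm[OF lim]]) (use bound in auto)
  then have g': "Infinite_Set_Sum.abs_summable_on g A"
    using h' by (intro abs_summable_on_comparison_test[OF h']) (use h0 in auto)
  have "(\<lambda>n. infsetsum (f n) A) \<longlonglongrightarrow> infsetsum g A"
    unfolding infsetsum_def
  proof (rule integral_dominated_convergence)
    show "integrable (count_space A) h"
      using h' by (simp add: abs_summable_on_def)
  qed (use lim bound in auto)
  then show ?thesis
    by (simp add: infsetsum_infsum f' g')
qed

lemma pochhammer_inf_self_nonzero:
  assumes "norm r < 1"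
  shows "pochhammer_inf r r \<noteq> 0"
proof
  assume "pochhammer_inf r r = 0"
  then obtain n where "r * r ^ n = 1"
    by (auto simp: pochhammer_inf_eq_0_iff assms)
  then have "1 - r * r ^ n = 0" by simp
  then show False
    using qfact_nonzero[OF assms, of "Suc n"] by simp
qed

lemma qbinom_central_LIMSEQ:
  assumes "norm r < 1"
  shows "(\<lambda>n. qbinom r (n + n) (int n + j)) \<longlonglongrightarrow> 1 / pochhammer_inf r r"
proof -
  let ?F = "\<lambda>n. \<Prod>i<n. 1 - r * r ^ i"
  have lim: "filterlim (\<lambda>n. n + n) at_top sequentially"
    "filterlim (\<lambda>n. nat (int n + j)) at_top sequentially"
    "filterlim (\<lambda>n. nat (int n - j)) at_top sequentially"
    by (auto simp: filterlim_at_top eventually_sequentially intro: exI[of _ "nat (_ + \<bar>j\<bar>)"])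
     (rule_tac x="nat (int Z + \<bar>j\<bar>)" in exI; linarith)+
  have "(\<lambda>n. ?F (n + n) / (?F (nat (int n + j)) * ?F (nat (int n - j)))) \<longlonglongrightarrow>
     pochhammer_inf r r / (pochhammer_inf r r * pochhammer_inf r r)"
    by (intro tendsto_intros filterlim_compose[OF pochhammer_inf_LIMSEQ[OF assms]] lim)
      (use pochhammer_inf_self_nonzero[OF assms] in auto)
  moreover have "eventually (\<lambda>n. ?F (n + n) / (?F (nat (int n + j)) * ?F (nat (int n - j)))
    = qbinom r (n + n) (int n + j)) sequentially"
    using eventually_ge_at_top[of "nat \<bar>j\<bar>"]
    by eventually_elim (auto simp: qbinom_def)
  ultimately show ?thesis
    using pochhammer_inf_self_nonzero[OF assms] by (auto intro: Lim_transform_eventually)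
qed

text \<open>
The finite products of \<open>1 - r\<^bsup>i+1\<^esup>\<close> are nonzero and converge to a nonzero limit, hence they and
their inverses are bounded. This supplies the dominating series in the limit of
the finite triple product.
\<close>
lemma qbinom_bounded:
  assumes "norm r < 1"
  obtains M where "\<And>N k. norm (qbinom r N k) \<le> M"
proof -
  let ?F = "\<lambda>n. \<Prod>i<n. 1 - r * r ^ i"
  have "Bseq ?F"
    using pochhammer_inf_LIMSEQ[OF assms] by (intro convergent_imp_Bseq) (auto simp: convergent_def)
  then obtain B where B: "B > 0" "\<And>n. norm (?F n) \<le> B"
    by (auto simp: Bseq_def)
  have "Bseq (\<lambda>n. inverse (?F n))"
    using tendsto_inverse[OF pochhammer_inf_LIMSEQ[OF assms] pochhammer_inf_self_nonzero[OF assms]]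
    by (intro convergent_imp_Bseq) (auto simp: convergent_def)
  then obtain D where D: "D > 0" "\<And>n. norm (inverse (?F n)) \<le> D"
    by (auto simp: Bseq_def)
  show thesis
  proof (rule that)
    show "norm (qbinom r N k) \<le> B * (D * D)" for N k
    proof (cases "0 \<le> k \<and> k \<le> int N")
      case True
      then have "norm (qbinom r N k)
        = norm (?F N) * (norm (inverse (?F (nat k))) * norm (inverse (?F (nat (int N - k)))))"
        by (simp add: qbinom_def norm_mult norm_divide norm_inverse divide_inverse)
      also have "\<dots> \<le> B * (D * D)"
        using B D by (intro mult_mono) auto
      finally show ?thesis .
    next
      case False
      then show ?thesis using B D by (auto simp: qbinom_def)
    qed
  qed
qed

text \<open>
The limit \<open>m = n \<rightarrow> \<infinity>\<close> of the finite identity: every coefficient tends to \<open>1 / (r; r)\<close> with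
\<open>r = a b\<close>, which is the factor moved to the other side.
\<close>
theorem jacobi_triple_product:
  assumes r: "norm (a * b) < 1"
  shows "(ramanujan_term a b has_sum
    (pochhammer_inf (a * b) (a * b) * pochhammer_inf (- a) (a * b) * pochhammer_inf (- b) (a * b)))
      UNIV"
proof -
  let ?r = "a * b" and ?\<phi> = "pochhammer_inf (a * b) (a * b)"
  obtain M where M: "norm (qbinom ?r N k) \<le> M" for N k
    using qbinom_bounded[OF r] by blast
  have "(\<lambda>n. \<Sum>\<^sub>\<infinity>j. qbinom ?r (n + n) (int n + j) * ramanujan_term a b j)
    \<longlonglongrightarrow> (\<Sum>\<^sub>\<infinity>j. 1 / ?\<phi> * ramanujan_term a b j)"
  proof (rule tendsto_infsum_dominated)
    show "(\<lambda>n. qbinom ?r (n + n) (int n + j) * ramanujan_term a b j) \<longlonglongrightarrow> 1 / ?\<phi>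
      * ramanujan_term a b j" for j
      by (intro tendsto_intros qbinom_central_LIMSEQ r)
    show "norm (qbinom ?r (n + n) (int n + j) * ramanujan_term a b j) \<le> M
      * norm (ramanujan_term a b j)" for n j
      using M by (simp add: norm_mult mult_right_mono)
    show "(\<lambda>j. M * norm (ramanujan_term a b j)) summable_on UNIV"
      by (intro summable_on_cmult_right abs_summable_ramanujan_term r)
  qed
  moreover have "(\<Sum>\<^sub>\<infinity>j. qbinom ?r (n + n) (int n + j) * ramanujan_term a b j) =
      (\<Prod>k<n. 1 - (- a) * ?r ^ k) * (\<Prod>k<n. 1 - (- b) * ?r ^ k)" for n
    using infsumI[OF finite_triple_product[OF r, of n n]] by simp
  moreover have "(\<lambda>n. (\<Prod>k<n. 1 - (- a) * ?r ^ k) * (\<Prod>k<n. 1 - (- b) * ?r ^ k)) \<longlonglongrightarrow>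
      pochhammer_inf (- a) ?r * pochhammer_inf (- b) ?r"
    by (intro tendsto_intros pochhammer_inf_LIMSEQ r)
  ultimately have "(\<Sum>\<^sub>\<infinity>j. 1 / ?\<phi> * ramanujan_term a b j)
    = pochhammer_inf (- a) ?r * pochhammer_inf (- b) ?r"
    using LIMSEQ_unique by simp
  then have "infsum (ramanujan_term a b) UNIV
    = ?\<phi> * pochhammer_inf (- a) ?r * pochhammer_inf (- b) ?r"
    unfolding infsum_cmult_right' using pochhammer_inf_self_nonzero[OF r] by (simp add: field_simps)
  moreover have "ramanujan_term a b summable_on UNIV"
    using abs_summable_ramanujan_term[OF r] by (rule Infinite_Sum.abs_summable_summable)
  ultimately show ?thesis
    by (simp add: has_sum_iff)
qed

section \<open>The addition formula\<close>

lemma has_sum_product: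
  fixes f :: "'a \<Rightarrow> 'c :: {banach, real_normed_div_algebra}"
  assumes f: "(f has_sum S) A" "(\<lambda>x. norm (f x)) summable_on A"
    and g: "(g has_sum T) B" "(\<lambda>y. norm (g y)) summable_on B"
  shows "((\<lambda>(x, y). f x * g y) has_sum (S * T)) (A \<times> B)"
proof (rule has_sum_SigmaI)
  show "((\<lambda>y. case (x, y) of (x, y) \<Rightarrow> f x * g y) has_sum (f x * T)) B" for x
    using has_sum_cmult_right[OF g(1)] by simp
  show "((\<lambda>x. f x * T) has_sum (S * T)) A"
    by (rule has_sum_cmult_left[OF f(1)])
  have "(\<lambda>p. norm (case p of (x, y) \<Rightarrow> f x * g y)) summable_on A \<times> B"
  proof (rule summable_on_SigmaI)
    show "((\<lambda>y. norm (case (x, y) of (x, y) \<Rightarrow> f x * g y))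
      has_sum (norm (f x) * infsum (\<lambda>y. norm (g y)) B)) B" for x
      using has_sum_cmult_right[OF has_sum_infsum[OF g(2)]] by (simp add: norm_mult)
    show "(\<lambda>x. norm (f x) * infsum (\<lambda>y. norm (g y)) B) summable_on A"
      by (rule summable_on_cmult_left[OF f(2)])
  qed auto
  then show "(\<lambda>(x, y). f x * g y) summable_on A \<times> B"
    by (rule Infinite_Sum.abs_summable_summable)
qed

lemma jtheta_has_sum:
  assumes "norm p < 1" "z \<noteq> 0"
  shows "(ramanujan_term (- z) (- p / z) has_sum (pochhammer_inf p p * jtheta z p)) UNIV"
  using jacobi_triple_product[of "- z" "- p / z"] assms
    by (simp add: jtheta_eq_pochhammer_inf mult_ac)

text \<open>
The triple product with nome \<open>p\<^sup>2\<close> carries the factor \<open>(p\<^sup>2; p\<^sup>2)\<close>, which splits as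
\<open>(p; p) (-p; p)\<close>. The second factor is the normalisation in \<open>P\<close> and \<open>Q\<close>, so that their series have
the same prefactor \<open>(p; p)\<close> as that of \<open>\<theta>(z; p)\<close>.
\<close>
lemma ellP_has_sum:
  assumes "norm p < 1" "x \<noteq> 0"
  shows "(ramanujan_term (x ^ 2) (p ^ 2 / x ^ 2) has_sum (pochhammer_inf p p * ellP p x)) UNIV"
proof -
  have "norm (p ^ 2) < 1"
    using assms(1) by (simp add: norm_power power_less_one_iff)
  then show ?thesis
    using jtheta_has_sum[of "p ^ 2" "- (x ^ 2)"] assms
    by (simp add: ellP_def pochhammer_inf_square mult_ac)
qed

lemma ellQ_has_sum:
  assumes "norm p < 1" "x \<noteq> 0"
  shows "((\<lambda>j. x * ramanujan_term (p * x ^ 2) (p / x ^ 2) j)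
    has_sum (pochhammer_inf p p * ellQ p x)) UNIV"
proof -
  have "norm (p ^ 2) < 1"
    using assms(1) by (simp add: norm_power power_less_one_iff)
  moreover have "p * x ^ 2 * (p / x ^ 2) = p ^ 2"
    using assms(2) by (simp add: power2_eq_square)
  ultimately show ?thesis
    using has_sum_cmult_right[OF jacobi_triple_product[of "p * x ^ 2" "p / x ^ 2"], of x]
    by (simp add: ellQ_eq[OF assms(1)] pochhammer_inf_square[OF assms(1)] mult_ac)
qed

lemma abs_summable_jtheta_series:
  assumes "norm p < 1" "z \<noteq> 0"
  shows "(\<lambda>j. norm (ramanujan_term (- z) (- p / z) j)) summable_on UNIV"
  by (rule abs_summable_ramanujan_term) (use assms in simp)

lemma abs_summable_ellP_series:
  assumes "norm p < 1" "x \<noteq> 0"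
  shows "(\<lambda>j. norm (ramanujan_term (x ^ 2) (p ^ 2 / x ^ 2) j)) summable_on UNIV"
  by (rule abs_summable_ramanujan_term) (use assms in \<open>simp add: norm_power power_less_one_iff\<close>)

lemma abs_summable_ellQ_series:
  assumes "norm p < 1" "x \<noteq> 0"
  shows "(\<lambda>j. norm (x * ramanujan_term (p * x ^ 2) (p / x ^ 2) j)) summable_on UNIV"
  unfolding norm_mult
  by (intro summable_on_cmult_right abs_summable_ramanujan_term)
    (use assms in \<open>simp add: norm_power power_less_one_iff flip: power2_eq_square\<close>)

lemma jtheta_series_term:
  assumes "z \<noteq> 0"
  shows "ramanujan_term (- z) (- p / z) j = (- z) powi j * p ^ nat (j * (j - 1) div 2)"
  using ramanujan_term_scale[of "- z" 1 p j] assms by (simp add: ramanujan_term_def)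

lemma ellP_series_term:
  assumes "x \<noteq> 0"
  shows "ramanujan_term (x ^ 2) (p ^ 2 / x ^ 2) j = x powi (2 * j) * p ^ nat (j * (j - 1))"
proof -
  have "2 * (j * (j - 1) div 2) = j * (j - 1)" by simp
  then have *: "2 * nat (j * (j - 1) div 2) = nat (j * (j - 1))"
    using triangular_pred_nonneg[of j] by linarith
  show ?thesis
    using ramanujan_term_scale[of "x ^ 2" 1 "p ^ 2" j] assms
    by (simp add: ramanujan_term_def power_int_mult flip: power_mult *)
qed

lemma ellQ_series_term:
  assumes "x \<noteq> 0"
  shows "x * ramanujan_term (p * x ^ 2) (p / x ^ 2) j = x powi (2 * j + 1) * p ^ nat (j * j)"
proof -
  have "2 * (j * (j - 1) div 2) = j * (j - 1)" "2 * (j * (j + 1) div 2) = j * (j + 1)" by simp_all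
  moreover have "j * (j - 1) + j * (j + 1) = 2 * (j * j)" by (simp add: algebra_simps)
  ultimately have "j * (j + 1) div 2 + j * (j - 1) div 2 = j * j"
    by linarith
  then have *: "nat (j * j) = nat (j * (j + 1) div 2) + nat (j * (j - 1) div 2)"
    using triangular_nonneg[of j] triangular_pred_nonneg[of j] by linarith
  have "x powi (2 * j + 1) = (x ^ 2) powi j * x"
    using assms by (simp add: power_int_mult power_int_add)
  then show ?thesis
    using ramanujan_term_scale[of "x ^ 2" p p j] assms unfolding *
    by (simp add: ramanujan_term_def power_add mult.commute[of p "x ^ 2"])
qed

lemma nat_add_half:
  fixes u v k l :: int
  assumes "even u" "even v" "u \<ge> 0" "v \<ge> 0" "u + v = 2 * (k + l)" "k \<ge> 0" "l \<ge> 0"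
  shows "nat (u div 2) + nat (v div 2) = nat k + nat l"
  using assms by (auto elim!: evenE)

lemma pronic_nonneg: "0 \<le> j * (j - 1 :: int)"
  using triangular_pred_nonneg[of j] by simp

text \<open>
The exponents of \<open>p\<close> separate because \<open>m\<^sup>2 + n\<^sup>2 = 2 s\<^sup>2 + 2 t\<^sup>2\<close> for \<open>m = s + t\<close> and
\<open>n = s - t\<close>.
\<close>
lemma triangular_even_split:
  "nat ((s + t) * (s + t - 1) div 2) + nat ((s - t) * (s - t - 1) div 2)
    = nat (s * (s - 1)) + nat (t * t)"
proof (rule nat_add_half)
  show "(s + t) * (s + t - 1) + (s - t) * (s - t - 1) = 2 * (s * (s - 1) + t * t)"
    by (simp add: algebra_simps)
qed (use pronic_nonneg[of "s + t"] pronic_nonneg[of "s - t"] pronic_nonneg[of s] in auto)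

lemma triangular_odd_split:
  "nat ((s + t) * (s + t - 1) div 2) + nat ((s - t + 1) * (s - t + 1 - 1) div 2)
    = nat (s * s) + nat (t * (t - 1))"
proof (rule nat_add_half)
  show "(s + t) * (s + t - 1) + (s - t + 1) * (s - t + 1 - 1) = 2 * (s * s + t * (t - 1))"
    by (simp add: algebra_simps)
qed (use pronic_nonneg[of "s + t"] pronic_nonneg[of "s - t + 1"] pronic_nonneg[of t] in auto)

text \<open>
Up to the factor \<open>(p; p)\<^sup>2\<close>, the double series of \<open>y \<theta>(x y; p) \<theta>(x / y; p)\<close> has the terms
\<open>(-1)\<^bsup>m+n\<^esup> x\<^bsup>m+n\<^esup> y\<^bsup>m-n+1\<^esup> p\<^bsup>e(m)+e(n)\<^esup>\<close> with \<open>e(j) = j (j - 1) / 2\<close>. Sorted by the parity of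
\<open>m + n\<close>, it becomes a difference of two products of single series.
\<close>
theorem theta_addition:
  assumes p: "norm p < 1" and "x \<noteq> 0" "y \<noteq> 0"
  shows "ellP p x * ellQ p y - ellQ p x * ellP p y = y * jtheta (x * y) p * jtheta (x / y) p"
proof -
  let ?\<phi> = "pochhammer_inf p p"
  let ?e = "\<lambda>j::int. nat (j * (j - 1) div 2)"
  define P Q where "P = (\<lambda>x j. ramanujan_term (x ^ 2) (p ^ 2 / x ^ 2) j)"
    and "Q = (\<lambda>x j. x * ramanujan_term (p * x ^ 2) (p / x ^ 2) j)"
  define J where "J = (\<lambda>z j. ramanujan_term (- z) (- p / z) j)"
  define h where "h = (\<lambda>(m, n). y * (J (x * y) m * J (x / y) n))"
  have PQ: "P x s = x powi (2 * s) * p ^ nat (s * (s - 1))"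
    "Q x s = x powi (2 * s + 1) * p ^ nat (s * s)" if "x \<noteq> 0" for x s
    using that by (simp_all add: P_def Q_def ellP_series_term ellQ_series_term)
  have "((\<lambda>(m, n). J (x * y) m * J (x / y) n)
    has_sum ((?\<phi> * jtheta (x * y) p) * (?\<phi> * jtheta (x / y) p))) (UNIV \<times> UNIV)"
    unfolding J_def by (intro has_sum_product jtheta_has_sum abs_summable_jtheta_series p)
      (use assms in auto)
  then have h: "(h has_sum (y * ((?\<phi> * jtheta (x * y) p) * (?\<phi> * jtheta (x / y) p)))) UNIV"
    unfolding h_def case_prod_unfold UNIV_Times_UNIV by (rule has_sum_cmult_right)
  have h_eq: "h (m, n) = (- 1) powi (m + n) * x powi (m + n) * y powi (m - n + 1)
    * p ^ (?e m + ?e n)" for m n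
  proof -
    have "J (x * y) m = (-1) powi m * x powi m * y powi m * p ^ ?e m"
      "J (x / y) n = (-1) powi n * x powi n / y powi n * p ^ ?e n"
      using power_int_mult_distrib[of "-1" "x * y" m] power_int_mult_distrib[of "-1" "x / y" n]
        assms
        jtheta_series_term[of "x * y" p m] jtheta_series_term[of "x / y" p n]
      by (simp_all add: J_def power_int_mult_distrib power_int_divide_distrib)
    then show ?thesis
      using assms by (simp add: h_def power_int_add power_int_diff power_add)
  qed
  have "((\<lambda>(s, t). P x s * Q y t) has_sum ((?\<phi> * ellP p x) * (?\<phi> * ellQ p y))) (UNIV \<times> UNIV)"
    unfolding P_def Q_def
    by (intro has_sum_product ellP_has_sum ellQ_has_sum abs_summable_ellP_series
      abs_summable_ellQ_series assms)
  also have "((\<lambda>(s, t). P x s * Q y t) has_sum ((?\<phi> * ellP p x) * (?\<phi> * ellQ p y))) (UNIV \<times> UNIV) \<longleftrightarrow>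
     (h has_sum ((?\<phi> * ellP p x) * (?\<phi> * ellQ p y))) {(m, n). even (m + n)}"
  proof (rule has_sum_reindex_bij_witness[of _ "\<lambda>(m, n). ((m + n) div 2, (m - n) div 2)"
    "\<lambda>(s, t). (s + t, s - t)"])
    fix a :: "int \<times> int"
    obtain s t where [simp]: "a = (s, t)" by fastforce
    have "h (s + t, s - t) = P x s * Q y t"
      unfolding h_eq triangular_even_split using assms by (simp add: PQ power_add)
    then show "h (case a of (s, t) \<Rightarrow> (s + t, s - t)) = (case a of (s, t) \<Rightarrow> P x s * Q y t)" by simp
  next
    fix b :: "int \<times> int" assume "b \<in> {(m, n). even (m + n)}"
    then obtain m n where b: "b = (m, n)" "even (m + n)" by blast
    from b(2) obtain k where "m + n = 2 * k" by (rule evenE)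
    then have n: "n = 2 * k - m" by simp
    show "(case case b of (m, n) \<Rightarrow> ((m + n) div 2, (m - n) div 2) of (s, t) \<Rightarrow> (s + t, s - t)) = b"
      unfolding b(1) n by simp
  qed auto
  finally have even: "(h has_sum ((?\<phi> * ellP p x) * (?\<phi> * ellQ p y))) {(m, n). even (m + n)}" .
  have "((\<lambda>(s, t). Q x s * P y t) has_sum ((?\<phi> * ellQ p x) * (?\<phi> * ellP p y))) (UNIV \<times> UNIV)"
    unfolding P_def Q_def
    by (intro has_sum_product ellP_has_sum ellQ_has_sum abs_summable_ellP_series
      abs_summable_ellQ_series assms)
  then have "((\<lambda>(s, t). - (Q x s * P y t))
    has_sum (- ((?\<phi> * ellQ p x) * (?\<phi> * ellP p y)))) (UNIV \<times> UNIV)"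
    unfolding case_prod_unfold by (rule has_sum_uminusI)
  also have "((\<lambda>(s, t). - (Q x s * P y t))
    has_sum (- ((?\<phi> * ellQ p x) * (?\<phi> * ellP p y)))) (UNIV \<times> UNIV) \<longleftrightarrow>
     (h has_sum (- ((?\<phi> * ellQ p x) * (?\<phi> * ellP p y)))) {(m, n). odd (m + n)}"
  proof (rule has_sum_reindex_bij_witness[of _ "\<lambda>(m, n). ((m + n) div 2, (m - n + 1) div 2)"
    "\<lambda>(s, t). (s + t, s - t + 1)"])
    fix a :: "int \<times> int"
    obtain s t where [simp]: "a = (s, t)" by fastforce
    have "h (s + t, s - t + 1) = - (Q x s * P y t)"
      unfolding h_eq triangular_odd_split using assms by (simp add: PQ power_add power_int_add)
    then show "h (case a of (s, t) \<Rightarrow> (s + t, s - t + 1)) = (case a of (s, t) \<Rightarrow> - (Q x s * P y t))"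
      by simp
  next
    fix b :: "int \<times> int" assume "b \<in> {(m, n). odd (m + n)}"
    then obtain m n where b: "b = (m, n)" "odd (m + n)" by blast
    from b(2) obtain k where "m + n = 2 * k + 1" by (rule oddE)
    then have n: "n = 2 * k + 1 - m" by simp
    show "(case case b of (m, n) \<Rightarrow> ((m + n) div 2, (m - n + 1) div 2) of (s, t) \<Rightarrow> (s + t, s - t
      + 1)) = b"
      unfolding b(1) n by simp
  qed auto
  finally have odd: "(h has_sum (- ((?\<phi> * ellQ p x) * (?\<phi> * ellP p y)))) {(m, n). odd (m + n)}" .
  have U: "{(m, n). even (m + n)} \<union> {(m, n). odd (m + n)} = (UNIV :: (int \<times> int) set)" by auto
  have "(h has_sum ((?\<phi> * ellP p x) * (?\<phi> * ellQ p y)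
    + - ((?\<phi> * ellQ p x) * (?\<phi> * ellP p y)))) UNIV"
    unfolding U[symmetric] by (rule has_sum_Un_disjoint[OF even odd]) auto
  from has_sum_unique[OF this h]
  have "?\<phi> ^ 2 * (ellP p x * ellQ p y - ellQ p x * ellP p y)
    = ?\<phi> ^ 2 * (y * jtheta (x * y) p * jtheta (x / y) p)"
    by (simp add: algebra_simps power2_eq_square)
  then show ?thesis
    using pochhammer_inf_self_nonzero[OF p] by simp
qed

section \<open>Lagrange interpolation of binary forms\<close>

text \<open>
If interpolation at the first \<open>N + 1\<close> nodes reproduces \<open>F\<close>, then one further node is enough for \<open>F\<close> times
a linear form \<open>L\<close>. In the \<open>k\<close>-th term of the expansion of \<open>F\<close>, interpolate \<open>L\<close> at the two nodes
\<open>k\<close> and \<open>N + 1\<close>. The values at node \<open>k\<close> yield the \<open>k\<close>-th basis function for \<open>N + 2\<close> nodes. The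
remaining parts all contain the same product over the old nodes, and their coefficients add up to the
value of \<open>F\<close> at the new node, again by the expansion of \<open>F\<close>.
\<close>
lemma lagrange_step:
  fixes u v :: "nat \<Rightarrow> 'a :: field"
  assumes distinct: "\<And>i j. i \<le> Suc N \<Longrightarrow> j \<le> Suc N \<Longrightarrow> i \<noteq> j \<Longrightarrow> u i * v j - v i * u j \<noteq> 0"
    and F: "\<And>s t. F s t
      = (\<Sum>k\<le>N. F (u k) (v k) * (\<Prod>j\<in>{..N}-{k}. (s * v j - t * u j) / (u k * v j - v k * u j)))"
  shows "F s t * (\<alpha> * s + \<beta> * t) = (\<Sum>k\<le>Suc N. F (u k) (v k) * (\<alpha> * u k + \<beta> * v k) *
    (\<Prod>j\<in>{..Suc N}-{k}. (s * v j - t * u j) / (u k * v j - v k * u j)))"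
proof -
  define L where "L = (\<lambda>s t. \<alpha> * s + \<beta> * t)"
  define E where "E = (\<lambda>k s t. \<Prod>j\<in>{..N}-{k}. (s * v j - t * u j) / (u k * v j - v k * u j))"
  define R where "R = (\<lambda>j. (s * v j - t * u j) / (u (Suc N) * v j - v (Suc N) * u j))"
  let ?n = "Suc N"
  have E_n: "E k s t * ((s * v ?n - t * u ?n) / (u k * v ?n - v k * u ?n)) =
    (\<Prod>j\<in>{..?n}-{k}. (s * v j - t * u j) / (u k * v j - v k * u j))" if "k \<le> N" for k
  proof -
    have "{..?n}-{k} = insert ?n ({..N}-{k})" using that by auto
    then show ?thesis by (simp add: E_def)
  qed
  \<comment> \<open>\<open>R j\<close> divides the determinant of \<open>(s, t)\<close> and node \<open>j\<close> by that of the new node and node \<open>j\<close>.\<close>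
  have E_R: "E k s t * R k = E k (u ?n) (v ?n) * (\<Prod>j\<le>N. R j)" if "k \<le> N" for k
  proof -
    have "E k s t = E k (u ?n) (v ?n) * (\<Prod>j\<in>{..N}-{k}. R j)"
      unfolding E_def prod.distrib[symmetric]
    proof (rule prod.cong)
      fix j assume "j \<in> {..N} - {k}"
      then show "(s * v j - t * u j) / (u k * v j - v k * u j) =
        (u ?n * v j - v ?n * u j) / (u k * v j - v k * u j) * R j"
        using distinct[of ?n j] by (simp add: R_def)
    qed simp
    moreover have "(\<Prod>j\<le>N. R j) = (\<Prod>j\<in>{..N}-{k}. R j) * R k"
      using that by (simp add: prod.remove[of "{..N}" k] mult.commute)
    ultimately show ?thesis by simp
  qed
  \<comment> \<open>Two-point interpolation of the linear form at the nodes \<open>k\<close> and \<open>N + 1\<close>.\<close>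
  have L: "L s t = L (u k) (v k) * ((s * v ?n - t * u ?n) / (u k * v ?n - v k * u ?n))
    + L (u ?n) (v ?n) * R k" if "k \<le> N" for k
  proof -
    define D where "D = u k * v ?n - v k * u ?n"
    have D: "D \<noteq> 0" "u ?n * v k - v ?n * u k = - D"
      using distinct[of k ?n] that by (auto simp: D_def algebra_simps)
    have "L s t * D = L (u k) (v k) * (s * v ?n - t * u ?n) - L (u ?n) (v ?n) * (s * v k - t * u k)"
      by (simp add: L_def D_def algebra_simps)
    then have "L s t = (L (u k) (v k) * (s * v ?n - t * u ?n) - L (u ?n) (v ?n)
      * (s * v k - t * u k)) / D"
      using D(1) by (simp add: eq_divide_eq)
    then show ?thesis
      unfolding R_def D(2) D_def[symmetric]
      by (simp add: diff_divide_distrib add_divide_distrib algebra_simps)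
  qed
  have "F s t * L s t = (\<Sum>k\<le>N. F (u k) (v k) * (E k s t * L s t))"
    using F[of s t] by (simp add: E_def sum_distrib_right mult.assoc)
  also have "\<dots> = (\<Sum>k\<le>N. F (u k) (v k) * L (u k) (v k)
    * (\<Prod>j\<in>{..?n}-{k}. (s * v j - t * u j) / (u k * v j - v k * u j))
     + F (u k) (v k) * E k (u ?n) (v ?n) * (L (u ?n) (v ?n) * (\<Prod>j\<le>N. R j)))"
  proof (rule sum.cong)
    fix k assume "k \<in> {..N}"
    then have k: "k \<le> N" by simp
    have "E k s t * L s t
      = L (u k) (v k) * (E k s t * ((s * v ?n - t * u ?n) / (u k * v ?n - v k * u ?n))) + L (u ?n)
        (v ?n) * (E k s t * R k)"
      unfolding L[OF k] by (simp only: distrib_left mult_ac)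
    then show "F (u k) (v k) * (E k s t * L s t)
      = F (u k) (v k) * L (u k) (v k) *
        (\<Prod>j\<in>{..?n}-{k}. (s * v j - t * u j) / (u k * v j - v k * u j))
     + F (u k) (v k) * E k (u ?n) (v ?n) * (L (u ?n) (v ?n) * (\<Prod>j\<le>N. R j))"
      unfolding E_n[OF k] E_R[OF k] by (simp only: distrib_left mult_ac)
  qed simp
  also have "\<dots> = (\<Sum>k\<le>N. F (u k) (v k) * L (u k) (v k)
    * (\<Prod>j\<in>{..?n}-{k}. (s * v j - t * u j) / (u k * v j - v k * u j)))
     + F (u ?n) (v ?n) * (L (u ?n) (v ?n) * (\<Prod>j\<le>N. R j))"
    using F[of "u ?n" "v ?n"] by (simp add: E_def sum.distrib sum_distrib_right)
  also have "(\<Prod>j\<le>N. R j) = (\<Prod>j\<in>{..?n}-{?n}. (s * v j - t * u j) / (u ?n * v j - v ?n * u j))"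
    by (rule prod.cong) (auto simp: R_def)
  finally show ?thesis
    by (simp add: L_def mult.assoc)
qed

lemma lagrange_monomial:
  fixes u v :: "nat \<Rightarrow> 'a :: field"
  assumes "\<And>i j. i \<le> N \<Longrightarrow> j \<le> N \<Longrightarrow> i \<noteq> j \<Longrightarrow> u i * v j - v i * u j \<noteq> 0" "i \<le> N"
  shows "s ^ i * t ^ (N - i) = (\<Sum>k\<le>N. u k ^ i * v k ^ (N - i) *
    (\<Prod>j\<in>{..N}-{k}. (s * v j - t * u j) / (u k * v j - v k * u j)))"
  using assms
proof (induction N arbitrary: i s t)
  case 0
  then show ?case by simp
next
  case (Suc N)
  show ?case
  proof (cases i)
    case 0
    have "s ^ 0 * t ^ (N - 0) = (\<Sum>k\<le>N. u k ^ 0 * v k ^ (N - 0) *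
      (\<Prod>j\<in>{..N}-{k}. (s * v j - t * u j) / (u k * v j - v k * u j)))" for s t
      by (rule Suc.IH) (use Suc.prems in auto)
    from lagrange_step[OF Suc.prems(1) this, of s t 0 1] show ?thesis
      by (simp add: 0 mult_ac del: sum.atMost_Suc)
  next
    case (Suc i')
    have "s ^ i' * t ^ (N - i') = (\<Sum>k\<le>N. u k ^ i' * v k ^ (N - i') *
      (\<Prod>j\<in>{..N}-{k}. (s * v j - t * u j) / (u k * v j - v k * u j)))" for s t
      by (rule Suc.IH) (use Suc.prems Suc in auto)
    from lagrange_step[OF Suc.prems(1) this, of s t 1 0] show ?thesis
      by (simp add: Suc mult_ac del: sum.atMost_Suc)
  qed
qed

text \<open>
The nodes are points \<open>(u\<^sub>k, v\<^sub>k)\<close> of the projective line, distinct in the sense that their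
determinants do not vanish. Working with pairs rather than with the quotients \<open>u\<^sub>k / v\<^sub>k\<close>
allows nodes at infinity, i.e. zeros of \<open>Q\<close>.
\<close>
theorem homogeneous_lagrange:
  fixes u v l :: "nat \<Rightarrow> 'a :: field"
  assumes "\<And>i j. i \<le> N \<Longrightarrow> j \<le> N \<Longrightarrow> i \<noteq> j \<Longrightarrow> u i * v j - v i * u j \<noteq> 0"
  shows "(\<Sum>i\<le>N. l i * s ^ i * t ^ (N - i)) = (\<Sum>k\<le>N. (\<Sum>i\<le>N. l i * u k ^ i * v k ^ (N - i)) *
    (\<Prod>j\<in>{..N}-{k}. (s * v j - t * u j) / (u k * v j - v k * u j)))"
proof -
  let ?E = "\<lambda>k. \<Prod>j\<in>{..N}-{k}. (s * v j - t * u j) / (u k * v j - v k * u j)"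
  have "(\<Sum>i\<le>N. l i * s ^ i * t ^ (N - i)) = (\<Sum>i\<le>N. l i * (\<Sum>k\<le>N. u k ^ i * v k ^ (N - i) * ?E k))"
    by (rule sum.cong) (use lagrange_monomial[of N u v _ s t, OF assms] in \<open>simp_all add:
      mult.assoc\<close>)
  also have "\<dots> = (\<Sum>k\<le>N. \<Sum>i\<le>N. l i * (u k ^ i * v k ^ (N - i) * ?E k))"
    unfolding sum_distrib_left by (rule sum.swap)
  also have "\<dots> = (\<Sum>k\<le>N. (\<Sum>i\<le>N. l i * u k ^ i * v k ^ (N - i)) * ?E k)"
    by (simp add: sum_distrib_right mult.assoc)
  finally show ?thesis .
qed

section \<open>The interpolation weights\<close>

lemma prod_lessThan_add:
  "(\<Prod>j<k + (m::nat). f j) = (\<Prod>j<k. f j) * (\<Prod>i<m. f (k + i) :: 'a :: comm_monoid_mult)"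
  by (induction m) (simp_all add: mult.assoc)

lemma prod_except:
  fixes f :: "nat \<Rightarrow> 'a :: comm_monoid_mult"
  shows "(\<Prod>j\<in>{..k + m}-{k}. f j) = (\<Prod>j<k. f j) * (\<Prod>i<m. f (k + 1 + i))"
proof -
  have "j < k \<or> j \<in> (\<lambda>i. k + 1 + i) ` {..<m}" if "j \<in> {..k + m}-{k}" for j
  proof (cases "j < k")
    case False
    then have "j = k + 1 + (j - k - 1)" "j - k - 1 < m" using that by auto
    then show ?thesis by blast
  qed simp
  then have "{..k + m}-{k} = {..<k} \<union> (\<lambda>i. k + 1 + i) ` {..<m}"
    by auto
  moreover have "(\<Prod>j\<in>(\<lambda>i. k + 1 + i) ` {..<m}. f j) = (\<Prod>i<m. f (k + 1 + i))"
    by (subst prod.reindex) (auto simp: inj_on_def)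
  moreover have "{..<k} \<inter> (\<lambda>i. k + 1 + i) ` {..<m} = {}"
    by auto
  ultimately show ?thesis
    using prod.union_disjoint[of "{..<k}" "(\<lambda>i. k + 1 + i) ` {..<m}" f] by simp
qed

lemma prod_reverse: "(\<Prod>j<n. f (n - j)) = (\<Prod>j<n. f (j + 1 :: nat) :: 'a :: comm_monoid_mult)"
  using prod.nat_diff_reindex[of "\<lambda>j. f (j + 1)" n] by (simp add: Suc_diff_Suc cong: prod.cong_simp)

text \<open>
The passage from Lagrange products to shifted factorials is an identity of finite products in any
field. Here \<open>a\<^sub>j\<close>, \<open>b\<^sub>j\<close>, \<open>c\<^sub>j\<close>, \<open>d\<^sub>j\<close> stand for \<open>\<theta>(C x q\<^sup>j; p)\<close>, \<open>\<theta>(C q\<^sup>j / x; p)\<close>, \<open>\<theta>(C\<^sup>2 q\<^sup>j; p)\<close>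
and \<open>\<theta>(q\<^sup>j; p)\<close>. Splitting every product at \<open>j = k\<close>, the second halves of the \<open>a\<close>- and
\<open>b\<close>-products cancel, the \<open>c\<close>-products are compared over the full range from \<open>0\<close> to \<open>N + k\<close>, and
the \<open>d\<close>-products are matched after reversing their order.
\<close>
lemma interpolation_weight:
  fixes a b c d :: "nat \<Rightarrow> 'a :: field"
  assumes "q \<noteq> 0" and kM: "N = k + M"
    and nz: "\<And>j. j < N \<Longrightarrow> a (j + 1) \<noteq> 0" "\<And>j. j < N \<Longrightarrow> b (j + 1) \<noteq> 0"
      "\<And>j. j < N \<Longrightarrow> d (j + 1) \<noteq> 0" "\<And>j. j \<le> 2 * N \<Longrightarrow> c j \<noteq> 0"
  shows "(\<Prod>j<N. d (j + 1)) * (\<Prod>j<N. c (j + 1)) / ((\<Prod>j<N. a (j + 1)) * (\<Prod>j<N. b (j + 1))) *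
    (\<Prod>j\<in>{..N}-{k}. a j * (- b j / q ^ j) /
      (c (k + j) * (if j < k then d (k - j) else - d (j - k) / q ^ (j - k))))
    = q ^ k * (c (2 * k) / c 0) *
      (((\<Prod>j<k. c j) * (\<Prod>j<k. b j) * (\<Prod>j<k. a j) * (\<Prod>j<k. - d (N - j) / q ^ (N - j))) /
      ((\<Prod>j<k. d (j + 1)) * (\<Prod>j<k. a (j + 1)) * (\<Prod>j<k. b (j + 1)) * (\<Prod>j<k. c (N + 1 + j))))"
proof -
  define A0 A1 A2 where "A0 = (\<Prod>j<k. a j)" and "A1 = (\<Prod>j<k. a (j + 1))"
    and "A2 = (\<Prod>i<M. a (k + 1 + i))"
  define B0 B1 B2 where "B0 = (\<Prod>j<k. b j)" and "B1 = (\<Prod>j<k. b (j + 1))"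
    and "B2 = (\<Prod>i<M. b (k + 1 + i))"
  define C0 C1 C2 C3 CN where "C0 = (\<Prod>j<k. c j)" and "C1 = (\<Prod>j<k. c (k + j))"
    and "C2 = (\<Prod>i<M. c (2 * k + 1 + i))"
    and "C3 = (\<Prod>j<k. c (N + 1 + j))" and "CN = (\<Prod>j<N. c (j + 1))"
  define D1 D2 D3 where "D1 = (\<Prod>j<k. d (j + 1))" and "D2 = (\<Prod>i<M. d (i + 1))"
    and "D3 = (\<Prod>j<k. d (N - j))"
  define Q where "Q = (\<Prod>j<k. q ^ j)"
  have "c (N + 1 + j) \<noteq> 0" if "j < k" for j
    using nz(4)[of "N + 1 + j"] that kM by simp
  then have "C3 \<noteq> 0" by (simp add: C3_def)
  moreover have "A1 \<noteq> 0" "A2 \<noteq> 0" "B1 \<noteq> 0" "B2 \<noteq> 0" "C1 \<noteq> 0" "C2 \<noteq> 0" "c 0 \<noteq> 0" "D1 \<noteq> 0" "D2 \<noteq> 0"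
    "Q \<noteq> 0"
    using nz \<open>q \<noteq> 0\<close> unfolding kM
      by (auto simp: A1_def A2_def B1_def B2_def C1_def C2_def D1_def D2_def Q_def)
  ultimately have nonzero: "A1 \<noteq> 0" "A2 \<noteq> 0" "B1 \<noteq> 0" "B2 \<noteq> 0" "C1 \<noteq> 0" "C2 \<noteq> 0" "C3 \<noteq> 0" "c 0 \<noteq> 0"
    "D1 \<noteq> 0" "D2 \<noteq> 0" "Q \<noteq> 0"
    by simp_all
  have AN: "(\<Prod>j<N. a (j + 1)) = A1 * A2" and BN: "(\<Prod>j<N. b (j + 1)) = B1 * B2"
    unfolding A1_def A2_def B1_def B2_def kM prod_lessThan_add
      by (simp_all add: add.commute add.left_commute)
  have DN: "(\<Prod>j<N. d (j + 1)) = D3 * D2"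
  proof -
    have "(\<Prod>j<N. d (j + 1)) = (\<Prod>j<k + M. d (N - j))"
      by (simp only: prod_reverse kM)
    also have "\<dots> = D3 * (\<Prod>i<M. d (M - i))"
      unfolding prod_lessThan_add D3_def by (simp add: kM)
    also have "(\<Prod>i<M. d (M - i)) = D2"
      by (simp add: D2_def prod_reverse)
    finally show ?thesis .
  qed
  \<comment> \<open>Both sides are the product of \<open>c 0, \<dots>, c (N + k)\<close>.\<close>
  have CN: "CN * (c 0 * C3) = c (2 * k) * C0 * (C1 * C2)"
  proof -
    have "CN * (c 0 * C3) = (\<Prod>j<1 + N + k. c j)"
      unfolding prod_lessThan_add by (simp add: CN_def C3_def)
    also have "1 + N + k = k + k + 1 + M" by (simp add: kM)
    also have "(\<Prod>j<k + k + 1 + M. c j) = C0 * C1 * c (2 * k) * C2"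
      unfolding prod_lessThan_add by (simp add: C0_def C1_def C2_def mult_2)
    finally show ?thesis by (simp add: mult_ac)
  qed
  have QN: "(\<Prod>j<k. q ^ (N - j)) = q ^ (k * M) * (q ^ k * Q)"
  proof -
    have "(\<Prod>j<k. q ^ (N - j)) = (\<Prod>j<k. q ^ M * q ^ (k - j))"
      by (rule prod.cong) (auto simp: kM simp flip: power_add intro!: arg_cong[of _ _ "power q"])
    also have "\<dots> = q ^ (k * M) * (\<Prod>j<k. q ^ (j + 1))"
      unfolding prod.distrib prod_reverse by (simp add: mult.commute flip: power_mult)
    also have "(\<Prod>j<k. q ^ (j + 1)) = q ^ k * Q"
      by (simp add: prod.distrib Q_def)
    finally show ?thesis .
  qed
  have "(\<Prod>j\<in>{..N}-{k}. a j * (- b j / q ^ j)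
    / (c (k + j) * (if j < k then d (k - j) else - d (j - k) / q ^ (j - k)))) =
    (\<Prod>j<k. - 1 * (a j * b j / (c (k + j) * d (k - j) * q ^ j))) *
    (\<Prod>i<M. a (k + 1 + i) * b (k + 1 + i) / (c (2 * k + 1 + i) * d (i + 1) * q ^ k))"
    unfolding kM prod_except
  proof (intro arg_cong2[of _ _ _ _ "(*)"] prod.cong)
    fix i
    show "a (k + 1 + i) * (- b (k + 1 + i) / q ^ (k + 1 + i)) / (c (k + (k + 1 + i)) *
      (if k + 1 + i < k then d (k - (k + 1 + i)) else - d (k + 1 + i - k) / q ^ (k + 1 + i - k))) =
      a (k + 1 + i) * b (k + 1 + i) / (c (2 * k + 1 + i) * d (i + 1) * q ^ k)"
      using \<open>q \<noteq> 0\<close> by (simp add: power_add mult_2 add.assoc)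
  qed auto
  also have "(\<Prod>j<k. - 1 * (a j * b j / (c (k + j) * d (k - j) * q ^ j)))
    = (- 1) ^ k * (A0 * B0 / (C1 * D1 * Q))"
    unfolding prod.distrib prod_dividef prod_reverse
      by (simp add: A0_def B0_def C1_def D1_def Q_def)
  also have "(\<Prod>i<M. a (k + 1 + i) * b (k + 1 + i) / (c (2 * k + 1 + i) * d (i + 1) * q ^ k))
    = A2 * B2 / (C2 * D2 * q ^ (k * M))"
    unfolding prod.distrib prod_dividef by (simp add: A2_def B2_def C2_def D2_def flip: power_mult)
  finally have P: "(\<Prod>j\<in>{..N}-{k}. a j * (- b j / q ^ j)
    / (c (k + j) * (if j < k then d (k - j) else - d (j - k) / q ^ (j - k)))) =
     (- 1) ^ k * (A0 * B0 / (C1 * D1 * Q)) * (A2 * B2 / (C2 * D2 * q ^ (k * M)))" .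
  have R: "(\<Prod>j<k. - d (N - j) / q ^ (N - j)) = (- 1) ^ k * D3 / (q ^ (k * M) * (q ^ k * Q))"
  proof -
    have "(\<Prod>j<k. - d (N - j) / q ^ (N - j)) = (\<Prod>j<k. - 1 * d (N - j)) / (\<Prod>j<k. q ^ (N - j))"
      by (simp only: prod_dividef mult_minus1)
    then show ?thesis
      unfolding prod.distrib QN by (simp add: D3_def)
  qed
  have CN': "CN = c (2 * k) * C0 * (C1 * C2) / (c 0 * C3)"
    using CN nonzero by (simp add: eq_divide_eq)
  show ?thesis
    unfolding P R AN BN DN CN_def[symmetric] CN' A0_def[symmetric] B0_def[symmetric]
      C0_def[symmetric] A1_def[symmetric]
      B1_def[symmetric] C3_def[symmetric] D1_def[symmetric]
    using nonzero \<open>q \<noteq> 0\<close> by (simp add: divide_simps)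
qed

text \<open>
The factor of index \<open>j\<close> in the \<open>k\<close>-th Lagrange basis function. The inversion of the theta
function makes all exponents of \<open>q\<close> nonnegative, and the factor \<open>C / x\<close> is one of the \<open>N\<close> in the
prefactor \<open>(C / x)\<^sup>N\<close>: each of the \<open>N\<close> indices \<open>j \<noteq> k\<close> absorbs one.
\<close>
lemma theta_factor_quotient:
  assumes p: "norm p < 1" and nz: "q \<noteq> 0" "C \<noteq> 0" "x \<noteq> 0" and "j \<noteq> k"
  shows "(C / x) * ((ellP p x * ellQ p (C * q ^ j) - ellQ p x * ellP p (C * q ^ j)) /
      (ellP p (C * q ^ k) * ellQ p (C * q ^ j) - ellQ p (C * q ^ k) * ellP p (C * q ^ j)))
    = jtheta (C * x * q ^ j) p * (- jtheta (C / x * q ^ j) p / q ^ j) /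
      (jtheta (C ^ 2 * q ^ (k + j)) p *
        (if j < k then jtheta (q ^ (k - j)) p else - jtheta (q ^ (j - k)) p / q ^ (j - k)))"
proof -
  have num: "ellP p x * ellQ p (C * q ^ j) - ellQ p x * ellP p (C * q ^ j) =
      C * q ^ j * (jtheta (C * x * q ^ j) p * (- (x / C) * jtheta (C / x * q ^ j) p / q ^ j))"
  proof -
    have *: "x / (C * q ^ j) = 1 / (C / x * q ^ j)" "x * (C * q ^ j) = C * x * q ^ j"
      using nz by simp_all
    have "jtheta (x / (C * q ^ j)) p = - (x / C) * jtheta (C / x * q ^ j) p / q ^ j"
      unfolding *(1) using jtheta_inverse[OF p, of "C / x * q ^ j"] nz by simp
    then show ?thesis
      using theta_addition[OF p, of x "C * q ^ j"] nz unfolding *(2) by simp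
  qed
  have quot: "jtheta (C * q ^ k / (C * q ^ j)) p
    = (if j < k then jtheta (q ^ (k - j)) p else - jtheta (q ^ (j - k)) p / q ^ (j - k))"
  proof (cases "j < k")
    case True
    then have "C * q ^ k / (C * q ^ j) = q ^ (k - j)" using nz by (simp add: power_diff)
    then show ?thesis using True by simp
  next
    case False
    then have "q ^ j = q ^ k * q ^ (j - k)" by (simp flip: power_add)
    then have "C * q ^ k / (C * q ^ j) = 1 / q ^ (j - k)" using nz by simp
    then show ?thesis using False jtheta_inverse[OF p, of "q ^ (j - k)"] nz by simp
  qed
  have den: "ellP p (C * q ^ k) * ellQ p (C * q ^ j) - ellQ p (C * q ^ k) * ellP p (C * q ^ j) =
      C * q ^ j * (jtheta (C ^ 2 * q ^ (k + j)) p *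
        (if j < k then jtheta (q ^ (k - j)) p else - jtheta (q ^ (j - k)) p / q ^ (j - k)))"
  proof -
    have "C * q ^ k * (C * q ^ j) = C ^ 2 * q ^ (k + j)"
      by (simp add: power_add power2_eq_square)
    then show ?thesis
      using theta_addition[OF p, of "C * q ^ k" "C * q ^ j"] nz quot by simp
  qed
  have cancel: "C / x * (Y * (A * (- (x / C) * B / Y')) / (Y * D)) = A * (- B / Y') / D" if "Y \<noteq> 0"
    for Y Y' A B D
    using nz that by simp
  show ?thesis
    unfolding num den by (rule cancel) (use nz in simp)
qed

text \<open>
When \<open>\<theta>(C\<^sup>2 q\<^sup>j; p)\<close> does not vanish for any \<open>j \<le> 2 N\<close>, the nodes \<open>C q\<^sup>k\<close> give distinct points
\<open>(P, Q)\<close>, and the expansion is the interpolation formula with the weights evaluated.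
\<close>
lemma expansion_at_distinct_nodes:
  fixes p q C x :: complex
  assumes p: "norm p < 1" and nz: "q \<noteq> 0" "C \<noteq> 0" "x \<noteq> 0"
    and a: "\<And>j. j < N \<Longrightarrow> jtheta (C * x * q ^ (j + 1)) p \<noteq> 0"
    and b: "\<And>j. j < N \<Longrightarrow> jtheta (C / x * q ^ (j + 1)) p \<noteq> 0"
    and d: "\<And>j. j < N \<Longrightarrow> jtheta (q ^ (j + 1)) p \<noteq> 0"
    and c: "\<And>j. j \<le> 2 * N \<Longrightarrow> jtheta (C ^ 2 * q ^ j) p \<noteq> 0"
    and f: "\<And>z. z \<noteq> 0 \<Longrightarrow> f z = (\<Sum>i\<le>N. l i * ellP p z ^ i * ellQ p z ^ (N - i))"
  shows "(C / x) ^ N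
      * (theta_facts [q, C ^ 2 * q] q p N / theta_facts [C * x * q, C * q / x] q p N) * f x
    = (\<Sum>k\<le>N. q ^ k * (jtheta (C ^ 2 * q ^ (2 * k)) p / jtheta (C ^ 2) p)
      * (theta_facts [C ^ 2, C / x, C * x, q powi (- int N)] q p k
        / theta_facts [q, C * x * q, C * q / x, C ^ 2 * q ^ (N + 1)] q p k)
      * f (C * q ^ k))"
proof -
  define u v where "u = (\<lambda>k. ellP p (C * q ^ k))" and "v = (\<lambda>k. ellQ p (C * q ^ k))"
  define G where "G = theta_facts [q, C ^ 2 * q] q p N / theta_facts [C * x * q, C * q / x] q p N"
  let ?a = "\<lambda>j. jtheta (C * x * q ^ j) p" and ?b = "\<lambda>j. jtheta (C / x * q ^ j) p"
  let ?c = "\<lambda>j. jtheta (C ^ 2 * q ^ j) p" and ?d = "\<lambda>j. jtheta (q ^ j) p"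
  let ?T = "\<lambda>k. q ^ k * (jtheta (C ^ 2 * q ^ (2 * k)) p / jtheta (C ^ 2) p)
      * (theta_facts [C ^ 2, C / x, C * x, q powi (- int N)] q p k
        / theta_facts [q, C * x * q, C * q / x, C ^ 2 * q ^ (N + 1)] q p k)"
  have distinct: "u i * v j - v i * u j \<noteq> 0" if "i \<le> N" "j \<le> N" "i \<noteq> j" for i j
  proof -
    have d': "?d m \<noteq> 0" if "0 < m" "m \<le> N" for m
      using d[of "m - 1"] that by simp
    have "jtheta (C * q ^ i / (C * q ^ j)) p \<noteq> 0"
    proof (cases "j < i")
      case True
      then have "C * q ^ i / (C * q ^ j) = q ^ (i - j)" using nz by (simp add: power_diff)
      then show ?thesis using d'[of "i - j"] that True by simp
    next
      case False
      then have "q ^ j = q ^ i * q ^ (j - i)" by (simp flip: power_add)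
      then have "C * q ^ i / (C * q ^ j) = 1 / q ^ (j - i)" using nz by simp
      then show ?thesis using jtheta_inverse[OF p, of "q ^ (j - i)"] nz d'[of "j - i"] that False
        by simp
    qed
    moreover have "C * q ^ i * (C * q ^ j) = C ^ 2 * q ^ (i + j)"
      by (simp add: power_add power2_eq_square)
    then have "jtheta (C * q ^ i * (C * q ^ j)) p \<noteq> 0"
      using c[of "i + j"] that by simp
    ultimately show ?thesis
      unfolding u_def v_def using theta_addition[OF p, of "C * q ^ i" "C * q ^ j"] nz by simp
  qed
  have weight: "(C / x) ^ N * G
    * (\<Prod>j\<in>{..N}-{k}. (ellP p x * v j - ellQ p x * u j) / (u k * v j - v k * u j)) = ?T k"
    if "k \<le> N" for k
  proof -
    have G_eq: "G = (\<Prod>j<N. ?d (j + 1)) * (\<Prod>j<N. ?c (j + 1))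
      / ((\<Prod>j<N. ?a (j + 1)) * (\<Prod>j<N. ?b (j + 1)))"
      by (simp add: G_def theta_facts_def theta_fact_def mult_ac)
    define M where "M = N - k"
    have M: "N = k + M" using that by (simp add: M_def)
    have "card ({..N} - {k}) = N" using that by simp
    then have "(C / x) ^ N = (\<Prod>j\<in>{..N}-{k}. C / x)" by (simp only: prod_constant)
    then have "(C / x) ^ N * G
      * (\<Prod>j\<in>{..N}-{k}. (ellP p x * v j - ellQ p x * u j) / (u k * v j - v k * u j))
      = G * (\<Prod>j\<in>{..N}-{k}. C / x * ((ellP p x * v j - ellQ p x * u j) / (u k * v j - v k * u j)))"
      by (simp only: prod.distrib mult_ac)
    also have "\<dots> = G
      * (\<Prod>j\<in>{..N}-{k}. ?a j * (- ?b j / q ^ j) /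
        (?c (k + j) * (if j < k then ?d (k - j) else - ?d (j - k) / q ^ (j - k))))"
      unfolding u_def v_def
        by (intro arg_cong2[of _ _ _ _ "(*)"] prod.cong refl theta_factor_quotient p nz) auto
    also have "\<dots> = q ^ k * (?c (2 * k) / ?c 0)
      * (((\<Prod>j<k. ?c j) * (\<Prod>j<k. ?b j) * (\<Prod>j<k. ?a j) * (\<Prod>j<k. - ?d (N - j) / q ^ (N - j))) /
      ((\<Prod>j<k. ?d (j + 1)) * (\<Prod>j<k. ?a (j + 1)) * (\<Prod>j<k. ?b (j + 1)) * (\<Prod>j<k. ?c (N + 1 + j))))"
      unfolding G_eq by (rule interpolation_weight[OF nz(1) M]) (use a b c d in auto)
    also have "(\<Prod>j<k. - ?d (N - j) / q ^ (N - j)) = theta_fact (q powi (- int N)) q p k"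
      unfolding theta_fact_def
    proof (rule prod.cong)
      fix j assume "j \<in> {..<k}"
      then have "q ^ N = q ^ (N - j) * q ^ j" using that by (simp flip: power_add)
      then have "q powi (- int N) * q ^ j = 1 / q ^ (N - j)"
        using nz by (simp add: power_int_minus inverse_eq_divide)
      then show "- ?d (N - j) / q ^ (N - j) = jtheta (q powi (- int N) * q ^ j) p"
        using jtheta_inverse[OF p, of "q ^ (N - j)"] nz by simp
    qed simp
    finally show ?thesis
      by (simp add: theta_facts_def theta_fact_def mult_ac power_add)
  qed
  have "f x = (\<Sum>k\<le>N. f (C * q ^ k)
    * (\<Prod>j\<in>{..N}-{k}. (ellP p x * v j - ellQ p x * u j) / (u k * v j - v k * u j)))"
    using homogeneous_lagrange[of N u v l "ellP p x" "ellQ p x", OF distinct] f nz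
    by (simp add: u_def v_def)
  then have "(C / x) ^ N * G * f x
    = (\<Sum>k\<le>N. ((C / x) ^ N * G *
      (\<Prod>j\<in>{..N}-{k}. (ellP p x * v j - ellQ p x * u j) / (u k * v j - v k * u j))) * f (C * q ^ k))"
    by (simp add: sum_distrib_left mult_ac)
  also have "\<dots> = (\<Sum>k\<le>N. ?T k * f (C * q ^ k))"
    using weight by (intro sum.cong) auto
  finally show ?thesis
    by (simp only: G_def)
qed

section \<open>Coinciding nodes\<close>

text \<open>
Every disc around \<open>C\<close> is uncountable.
\<close>
lemma frequently_not_in_countable:
  fixes C :: complex
  assumes "countable S"
  shows "frequently (\<lambda>z. z \<notin> S) (nhds C)"
  unfolding frequently_def
proof
  assume "eventually (\<lambda>z. \<not> z \<notin> S) (nhds C)"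
  then obtain e where "e > 0" "ball C e \<subseteq> S"
    by (auto simp: eventually_nhds_metric dist_commute subset_iff)
  then show False
    using uncountable_ball[of e C] assms countable_subset by blast
qed

lemma tendsto_theta_fact [tendsto_intros]:
  assumes "norm p < 1" "(g \<longlongrightarrow> c) F" "c \<noteq> 0" "q \<noteq> 0"
  shows "((\<lambda>z. theta_fact (g z) q p n) \<longlongrightarrow> theta_fact c q p n) F"
  unfolding theta_fact_def using assms by (intro tendsto_intros) auto

lemma theta_facts_Nil: "theta_facts [] q p n = 1"
  by (simp add: theta_facts_def)

lemma theta_facts_Cons: "theta_facts (y # ys) q p n = theta_fact y q p n * theta_facts ys q p n"
  by (simp add: theta_facts_def)

text \<open>
Near the given \<open>C\<close> the denominators stay nonzero, and outside the countable set where some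
\<open>\<theta>(C\<^sup>2 q\<^sup>j; p)\<close> vanishes, interpolation at distinct nodes applies. The identity thus holds at points
arbitrarily close to \<open>C\<close>, and by continuity at \<open>C\<close> itself.
\<close>
theorem theorem1p12:
  fixes p q C x :: complex and N :: nat and f :: "complex \<Rightarrow> complex"
  assumes "norm p < 1"
    and "q \<noteq> 0" and "C \<noteq> 0" and "x \<noteq> 0"
    and "theta_facts [C * x * q, C * q / x] q p N \<noteq> 0"
    and "jtheta (C ^ 2) p \<noteq> 0"
    and "\<And>k. k \<le> N \<Longrightarrow>
      theta_facts [q, C * x * q, C * q / x, C ^ 2 * q ^ (N + 1)] q p k \<noteq> 0"
    and "f \<in> elliptic_AW N (ellP p) (ellQ p)"
  shows "(C / x) ^ N
      * (theta_facts [q, C ^ 2 * q] q p N / theta_facts [C * x * q, C * q / x] q p N) * f x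
    = (\<Sum>k\<le>N. q ^ k * (jtheta (C ^ 2 * q ^ (2 * k)) p / jtheta (C ^ 2) p)
      * (theta_facts [C ^ 2, C / x, C * x, q powi (- int N)] q p k
        / theta_facts [q, C * x * q, C * q / x, C ^ 2 * q ^ (N + 1)] q p k)
      * f (C * q ^ k))"
proof -
  note p = assms(1) and q = assms(2) and C = assms(3) and x = assms(4)
  obtain l where l: "\<And>z. z \<noteq> 0 \<Longrightarrow> f z = (\<Sum>k\<le>N. l k * ellP p z ^ k * ellQ p z ^ (N - k))"
    using assms(8) by (auto simp: elliptic_AW_def)
  define lhs where "lhs = (\<lambda>C. (C / x) ^ N
      * (theta_facts [q, C ^ 2 * q] q p N / theta_facts [C * x * q, C * q / x] q p N) * f x)"
  define rhs where "rhs = (\<lambda>C. \<Sum>k\<le>N. q ^ k * (jtheta (C ^ 2 * q ^ (2 * k)) p / jtheta (C ^ 2) p)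
      * (theta_facts [C ^ 2, C / x, C * x, q powi (- int N)] q p k
        / theta_facts [q, C * x * q, C * q / x, C ^ 2 * q ^ (N + 1)] q p k)
      * f (C * q ^ k))"
  define den where "den = (\<lambda>C. theta_facts [q, C * x * q, C * q / x, C ^ 2 * q ^ (N + 1)] q p N)"
  have id: "((\<lambda>z. z) \<longlongrightarrow> C) (nhds C)"
    by (simp add: filterlim_def)
  \<comment> \<open>\<open>f\<close> is a form in \<open>P\<close> and \<open>Q\<close> only away from \<open>0\<close>, which suffices near the nonzero point \<open>C q\<^sup>k\<close>.\<close>
  have f_lim: "((\<lambda>z. f (z * q ^ k)) \<longlongrightarrow> f (C * q ^ k)) (nhds C)" for k
  proof -
    have "((\<lambda>z. \<Sum>i\<le>N. l i * ellP p (z * q ^ k) ^ i * ellQ p (z * q ^ k) ^ (N - i)) \<longlongrightarrow> f (C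
      * q ^ k)) (nhds C)"
      using p q C l[of "C * q ^ k"] by (auto intro!: tendsto_eq_intros id)
    moreover have "eventually (\<lambda>z. (\<Sum>i\<le>N. l i * ellP p (z * q ^ k) ^ i
      * ellQ p (z * q ^ k) ^ (N - i)) = f (z * q ^ k)) (nhds C)"
      using tendsto_imp_eventually_ne[OF id C] by eventually_elim (use l q in simp)
    ultimately show ?thesis
      by (rule Lim_transform_eventually)
  qed
  have lhs_lim: "(lhs \<longlongrightarrow> lhs C) (nhds C)"
    unfolding lhs_def theta_facts_Cons theta_facts_Nil
    by (intro tendsto_intros id p)
      (use q C x assms(5) in \<open>auto simp: theta_facts_Cons theta_facts_Nil\<close>)
  have rhs_lim: "(rhs \<longlongrightarrow> rhs C) (nhds C)"
    unfolding rhs_def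
  proof (rule tendsto_sum)
    fix k assume "k \<in> {..N}"
    then show "((\<lambda>C. q ^ k * (jtheta (C ^ 2 * q ^ (2 * k)) p / jtheta (C ^ 2) p)
      * (theta_facts [C ^ 2, C / x, C * x, q powi (- int N)] q p k
        / theta_facts [q, C * x * q, C * q / x, C ^ 2 * q ^ (N + 1)] q p k)
      * f (C * q ^ k)) \<longlongrightarrow> q ^ k * (jtheta (C ^ 2 * q ^ (2 * k)) p / jtheta (C ^ 2) p)
      * (theta_facts [C ^ 2, C / x, C * x, q powi (- int N)] q p k
        / theta_facts [q, C * x * q, C * q / x, C ^ 2 * q ^ (N + 1)] q p k)
      * f (C * q ^ k)) (nhds C)"
      unfolding theta_facts_Cons theta_facts_Nil
      by (intro tendsto_intros f_lim id p)
        (use q C x assms(6) assms(7)[of k] in \<open>auto simp: theta_facts_Cons theta_facts_Nil\<close>)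
  qed
  have den_lim: "(den \<longlongrightarrow> den C) (nhds C)"
    unfolding den_def theta_facts_Cons theta_facts_Nil
    by (intro tendsto_intros id p) (use q C x in auto)
  define S where "S = (\<Union>j. {z. z \<noteq> 0 \<and> jtheta (z ^ 2 * q ^ j) p = 0})"
  have "countable S"
    unfolding S_def
  proof (intro countable_UN)
    fix j
    have "{z. z \<noteq> 0 \<and> jtheta (z ^ 2 * q ^ j) p = 0} \<subseteq>
        (\<Union>w\<in>{w. w \<noteq> 0 \<and> jtheta w p = 0}. {z. z ^ 2 = w / q ^ j})"
    proof
      fix z assume "z \<in> {z. z \<noteq> 0 \<and> jtheta (z ^ 2 * q ^ j) p = 0}"
      then have "z ^ 2 * q ^ j \<in> {w. w \<noteq> 0 \<and> jtheta w p = 0}"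
        "z \<in> {z'. z' ^ 2 = z ^ 2 * q ^ j / q ^ j}"
        using q by auto
      then show "z \<in> (\<Union>w\<in>{w. w \<noteq> 0 \<and> jtheta w p = 0}. {z. z ^ 2 = w / q ^ j})"
        by (rule UN_I)
    qed
    moreover have "countable (\<Union>w\<in>{w. w \<noteq> 0 \<and> jtheta w p = 0}. {z. z ^ 2 = w / q ^ j})"
    proof (rule countable_UN)
      show "countable {z :: complex. z ^ 2 = w / q ^ j}" for w
        by (rule countable_finite) (simp add: finite_nth_roots)
    qed (rule countable_zeros_jtheta[OF p])
    ultimately show "countable {z. z \<noteq> 0 \<and> jtheta (z ^ 2 * q ^ j) p = 0}"
      by (rule countable_subset)
  qed auto
  have eq: "lhs z = rhs z" if z: "z \<noteq> 0" "den z \<noteq> 0" "z \<notin> S" for z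
    unfolding lhs_def rhs_def
  proof (rule expansion_at_distinct_nodes[OF p q z(1) x, where l = l])
    show "jtheta (z ^ 2 * q ^ j) p \<noteq> 0" for j
      using z by (auto simp: S_def)
  qed (use z(2) l in \<open>auto simp: den_def theta_facts_Cons theta_facts_Nil theta_fact_def mult_ac\<close>)
  have "eventually (\<lambda>z. z \<noteq> 0 \<and> den z \<noteq> 0) (nhds C)"
    using tendsto_imp_eventually_ne[OF id C] tendsto_imp_eventually_ne[OF den_lim] assms(7)[of N]
    by (intro eventually_conj) (auto simp: den_def)
  then have "frequently (\<lambda>z. z \<notin> S \<and> z \<noteq> 0 \<and> den z \<noteq> 0) (nhds C)"
    by (rule frequently_eventually_frequently[OF frequently_not_in_countable[OF \<open>countable S\<close>]])
  then have freq: "frequently (\<lambda>z. lhs z = rhs z) (nhds C)"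
    by (rule frequently_elim1) (use eq in auto)
  have "lhs C = rhs C"
  proof (rule ccontr)
    assume "lhs C \<noteq> rhs C"
    then have "eventually (\<lambda>z. lhs z - rhs z \<noteq> 0) (nhds C)"
      by (intro tendsto_imp_eventually_ne[OF tendsto_diff[OF lhs_lim rhs_lim]]) simp
    then show False
      using freq by (auto simp: frequently_def elim: eventually_mono)
  qed
  then show ?thesis
    by (simp only: lhs_def rhs_def)
qed

end
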